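(* Let $\mathcal{H}_N$, $\mathcal{H}_S$, $\mathcal{H}_T$ be finite-dimensional Hilbert spaces, let $\Phi=\Phi_{NS}$ be a density operator on $\mathcal{H}_N\otimes\mathcal{H}_S$ and $\Psi=\Psi_{NT}$ a density operator on $\mathcal{H}_N\otimes\mathcal{H}_T$. Then $\Phi$ is better than $\Psi$ (in the sense defined in the context) if and only if there exists a completely positive trace-preserving linear map $\mathcal{E}$ from operators on $\mathcal{H}_S$ to operators on $\mathcal{H}_T$ such that \[\Psi_{NT}=(\mathcal{I}_N\otimes\mathcal{E})\Phi_{NS},\] where $\mathcal{I}_N$ is the identity map on operators over $\mathcal{H}_N$.
   Context: An information structure is a triple $(\mathcal{H}_N,\mathcal{H}_S,\Phi_{NS})$ with $\mathcal{H}_N,\mathcal{H}_S$ finite-dimensional Hilbert spaces and $\Phi_{NS}$ a density operator on $\mathcal{H}_N\otimes\mathcal{H}_S$; the observer has access to $S$. A game is a tuple $(\mathcal{H}_A,\mathcal{H}_B,\rho_{AB},M^1,\dots,M^k)$ where $\mathcal{H}_A,\mathcal{H}_B$ are finite-dimensional Hilbert spaces (the environment), $\rho_{AB}$ is a density operator on $\mathcal{H}_A\otimes\mathcal{H}_B$, $k\ge 1$, and each $M^i$ is a Hermitian operator on $\mathcal{H}_N\otimes\mathcal{H}_B$. A strategy is a POVM $(D^1,\dots,D^k)$ on $\mathcal{H}_S\otimes\mathcal{H}_A$, i.e. positive semidefinite operators with $D^1+\dots+D^k=I$. The optimal payoff is \[R(\Phi_{NS};\rho_{AB},M^1,\dots,M^k)=\max_{(D^1,\dots,D^k)}\sum_{i=1}^k\operatorname{tr}\bigl((\Phi_{NS}\otimes\rho_{AB})(M^i_{NB}\otimes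 D^i_{SA})\bigr),\] the maximum over all strategies (tensor factors reordered appropriately). For information structures $\Phi_{NS}$ on $\mathcal{H}_N\otimes\mathcal{H}_S$ and $\Psi_{NT}$ on $\mathcal{H}_N\otimes\mathcal{H}_T$ (same $\mathcal{H}_N$), $\Phi$ is said to be better than $\Psi$ if for every finite-dimensional $\mathcal{H}_A,\mathcal{H}_B$, every density operator $\rho_{AB}$, every $k$ and every Hermitian $M^1,\dots,M^k$ on $\mathcal{H}_N\otimes\mathcal{H}_B$, one has $R(\Phi_{NS};\rho_{AB},M^1,\dots,M^k)\ge R(\Psi_{NT};\rho_{AB},M^1,\dots,M^k)$. *)

theory Defs
  imports Complex_Main "Jordan_Normal_Form.Matrix"
begin

(* Conventions: a d-dimensional Hilbert space is C^d; operators on it are d x d complex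
   matrices.  For spaces X, Y of dimensions dX, dY the tensor product X (x) Y has basis
   index (x,y) |-> x * dY + y. *)

definition mtrace :: "complex mat \<Rightarrow> complex" where
  "mtrace A = (\<Sum>i<dim_row A. A $$ (i, i))"

definition hermitian_op :: "nat \<Rightarrow> complex mat \<Rightarrow> bool" where
  "hermitian_op d A \<longleftrightarrow> A \<in> carrier_mat d d \<and>
     (\<forall>i<d. \<forall>j<d. A $$ (i, j) = cnj (A $$ (j, i)))"

definition psd_op :: "nat \<Rightarrow> complex mat \<Rightarrow> bool" where
  "psd_op d A \<longleftrightarrow> A \<in> carrier_mat d d \<and>
     (\<forall>v :: nat \<Rightarrow> complex.
        Im (\<Sum>i<d. \<Sum>j<d. cnj (v i) * A $$ (i, j) * v j) = 0 \<and>
        Re (\<Sum>i<d. \<Sum>j<d. cnj (v i) * A $$ (i, j) * v j) \<ge> 0)"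

definition density_op :: "nat \<Rightarrow> complex mat \<Rightarrow> bool" where
  "density_op d \<rho> \<longleftrightarrow> psd_op d \<rho> \<and> mtrace \<rho> = 1"

definition is_povm :: "nat \<Rightarrow> nat \<Rightarrow> (nat \<Rightarrow> complex mat) \<Rightarrow> bool" where
  "is_povm d k D \<longleftrightarrow> (\<forall>i<k. psd_op d (D i)) \<and>
     (\<forall>a<d. \<forall>b<d. (\<Sum>i<k. D i $$ (a, b)) = (if a = b then 1 else 0))"

(* sum_i tr((Phi_NS (x) rho_AB)(M^i_NB (x) D^i_SA)), tensor factors reordered to N S A B,
   written out entrywise *)
definition payoff ::
  "nat \<Rightarrow> nat \<Rightarrow> nat \<Rightarrow> nat \<Rightarrow> complex mat \<Rightarrow> complex mat \<Rightarrow> nat \<Rightarrow>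
   (nat \<Rightarrow> complex mat) \<Rightarrow> (nat \<Rightarrow> complex mat) \<Rightarrow> real" where
  "payoff dN dS dA dB \<Phi> \<rho> k M D = Re (\<Sum>i<k.
     \<Sum>n<dN. \<Sum>s<dS. \<Sum>a<dA. \<Sum>b<dB. \<Sum>n'<dN. \<Sum>s'<dS. \<Sum>a'<dA. \<Sum>b'<dB.
       \<Phi> $$ (n * dS + s, n' * dS + s') * \<rho> $$ (a * dB + b, a' * dB + b')
       * M i $$ (n' * dB + b', n * dB + b) * D i $$ (s' * dA + a', s * dA + a))"

definition opt_payoff ::
  "nat \<Rightarrow> nat \<Rightarrow> nat \<Rightarrow> nat \<Rightarrow> complex mat \<Rightarrow> complex mat \<Rightarrow> nat \<Rightarrow>
   (nat \<Rightarrow> complex mat) \<Rightarrow> real" where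
  "opt_payoff dN dS dA dB \<Phi> \<rho> k M =
     Sup {payoff dN dS dA dB \<Phi> \<rho> k M D | D. is_povm (dS * dA) k D}"

definition better ::
  "nat \<Rightarrow> nat \<Rightarrow> nat \<Rightarrow> complex mat \<Rightarrow> complex mat \<Rightarrow> bool" where
  "better dN dS dT \<Phi> \<Psi> \<longleftrightarrow>
     (\<forall>dA dB \<rho> k M. density_op (dA * dB) \<rho> \<and> k \<ge> 1 \<and>
        (\<forall>i<k. hermitian_op (dN * dB) (M i)) \<longrightarrow>
        opt_payoff dN dT dA dB \<Psi> \<rho> k M \<le> opt_payoff dN dS dA dB \<Phi> \<rho> k M)"

(* (I_m (x) E) X for X an operator on C^m (x) C^dS, E : ops on C^dS -> ops on C^dT *)
definition id_tensor ::
  "nat \<Rightarrow> nat \<Rightarrow> nat \<Rightarrow> (complex mat \<Rightarrow> complex mat) \<Rightarrow> complex mat \<Rightarrow> complex mat" where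
  "id_tensor m dS dT E X = mat (m * dT) (m * dT) (\<lambda>(p, q).
     E (mat dS dS (\<lambda>(s, s'). X $$ ((p div dT) * dS + s, (q div dT) * dS + s')))
       $$ (p mod dT, q mod dT))"

definition linear_op_map :: "nat \<Rightarrow> nat \<Rightarrow> (complex mat \<Rightarrow> complex mat) \<Rightarrow> bool" where
  "linear_op_map dS dT E \<longleftrightarrow>
     (\<forall>A \<in> carrier_mat dS dS. E A \<in> carrier_mat dT dT) \<and>
     (\<forall>A \<in> carrier_mat dS dS. \<forall>B \<in> carrier_mat dS dS. E (A + B) = E A + E B) \<and>
     (\<forall>c. \<forall>A \<in> carrier_mat dS dS. E (c \<cdot>\<^sub>m A) = c \<cdot>\<^sub>m E A)"

definition completely_positive :: "nat \<Rightarrow> nat \<Rightarrow> (complex mat \<Rightarrow> complex mat) \<Rightarrow> bool" where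
  "completely_positive dS dT E \<longleftrightarrow>
     (\<forall>m X. psd_op (m * dS) X \<longrightarrow> psd_op (m * dT) (id_tensor m dS dT E X))"

definition trace_preserving :: "nat \<Rightarrow> nat \<Rightarrow> (complex mat \<Rightarrow> complex mat) \<Rightarrow> bool" where
  "trace_preserving dS dT E \<longleftrightarrow> (\<forall>A \<in> carrier_mat dS dS. mtrace (E A) = mtrace A)"

definition cptp :: "nat \<Rightarrow> nat \<Rightarrow> (complex mat \<Rightarrow> complex mat) \<Rightarrow> bool" where
  "cptp dS dT E \<longleftrightarrow> linear_op_map dS dT E \<and> completely_positive dS dT E \<and>
     trace_preserving dS dT E"

end

theory Submission
  imports
    "HOL-Analysis.Topology_Euclidean_Space"
    "HOL-Analysis.Function_Topology"
    "HOL-Library.Complex_Order"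
    "HOL-Number_Theory.Cong"
    Defs
begin

text \<open>If \<open>\<Psi>\<close> arises from \<open>\<Phi>\<close> by a channel, a strategy for \<open>\<Psi>\<close> is turned into one for \<open>\<Phi>\<close> with the
  same payoff by applying the dual channel to the measurement.

  Conversely, the operators obtained from \<open>\<Phi>\<close> by channels form a compact convex set. If \<open>\<Psi>\<close> lies
  outside it, a Hermitian \<open>G\<close> separates: \<open>tr (G _)\<close> is larger at \<open>\<Psi>\<close> than on the whole set. In the
  game with \<open>\<rho>\<close> maximally entangled and payoffs \<open>U\<^sub>i G U\<^sub>i\<^sup>*\<close>, for the Weyl operators \<open>U\<^sub>i\<close>, the holder
  of \<open>\<Psi>\<close> teleports \<open>T\<close> onto \<open>B\<close> and earns \<open>tr (G \<Psi>)\<close>, whereas every strategy for \<open>\<Phi>\<close> implements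
  a channel from \<open>S\<close> to \<open>B\<close> and so earns at most the supremum over the set.\<close>

section \<open>Positive semidefinite kernels\<close>

type_synonym 'a kernel = "'a \<Rightarrow> 'a \<Rightarrow> complex"

definition quad_form :: "'a set \<Rightarrow> 'a kernel \<Rightarrow> ('a \<Rightarrow> complex) \<Rightarrow> complex" where
  "quad_form I A v = (\<Sum>i\<in>I. \<Sum>j\<in>I. cnj (v i) * A i j * v j)"

definition psd_on :: "'a set \<Rightarrow> 'a kernel \<Rightarrow> bool" where
  "psd_on I A \<longleftrightarrow> (\<forall>v. 0 \<le> quad_form I A v)"

definition hermitian_on :: "'a set \<Rightarrow> 'a kernel \<Rightarrow> bool" where
  "hermitian_on I A \<longleftrightarrow> (\<forall>p\<in>I. \<forall>q\<in>I. A q p = cnj (A p q))"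

definition rank_one_kernel :: "('a \<Rightarrow> complex) \<Rightarrow> 'a kernel" where
  "rank_one_kernel u p q = u p * cnj (u q)"

lemma psd_onI: "(\<And>v. 0 \<le> quad_form I A v) \<Longrightarrow> psd_on I A"
  by (simp add: psd_on_def)

lemma psd_onD: "psd_on I A \<Longrightarrow> 0 \<le> quad_form I A v"
  by (simp add: psd_on_def)

lemma hermitian_onD: "hermitian_on I A \<Longrightarrow> p \<in> I \<Longrightarrow> q \<in> I \<Longrightarrow> A q p = cnj (A p q)"
  unfolding hermitian_on_def by blast

lemma psd_on_cong:
  assumes "\<And>p q. p \<in> I \<Longrightarrow> q \<in> I \<Longrightarrow> A p q = B p q"
  shows "psd_on I A \<longleftrightarrow> psd_on I B"
proof -
  have "quad_form I A v = quad_form I B v" for v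
    unfolding quad_form_def using assms by (intro sum.cong refl) simp
  then show ?thesis by (simp add: psd_on_def)
qed

lemma cnj_mult_self_nonneg: "0 \<le> cnj z * z"
  by (simp add: less_eq_complex_def)

lemma psd_on_rank_one: "psd_on I (rank_one_kernel u)"
proof (rule psd_onI)
  fix v
  have "quad_form I (rank_one_kernel u) v = cnj (\<Sum>i\<in>I. cnj (u i) * v i) * (\<Sum>j\<in>I. cnj (u j) * v j)"
    unfolding quad_form_def rank_one_kernel_def cnj_sum sum_product by (simp add: mult_ac)
  then show "0 \<le> quad_form I (rank_one_kernel u) v"
    by (simp only: cnj_mult_self_nonneg)
qed

lemma psd_on_of_bool_eq:
  assumes "finite I"
  shows "psd_on I (\<lambda>p q. of_bool (p = q))"
proof (rule psd_onI)
  fix v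
  have "quad_form I (\<lambda>p q. of_bool (p = q)) v = (\<Sum>i\<in>I. cnj (v i) * v i)"
    using assms by (simp add: quad_form_def of_bool_def if_distrib if_distribR cong: if_cong)
  then show "0 \<le> quad_form I (\<lambda>p q. of_bool (p = q)) v"
    by (simp only: sum_nonneg cnj_mult_self_nonneg)
qed

lemma psd_on_add:
  assumes "psd_on I A" "psd_on I B"
  shows "psd_on I (\<lambda>p q. A p q + B p q)"
proof (rule psd_onI)
  fix v
  have "quad_form I (\<lambda>p q. A p q + B p q) v = quad_form I A v + quad_form I B v"
    by (simp add: quad_form_def algebra_simps sum.distrib)
  then show "0 \<le> quad_form I (\<lambda>p q. A p q + B p q) v"
    using assms by (simp add: psd_onD)
qed

lemma psd_on_sum:
  assumes "\<And>k. k \<in> X \<Longrightarrow> psd_on I (A k)"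
  shows "psd_on I (\<lambda>p q. \<Sum>k\<in>X. A k p q)"
  using assms
proof (induction X rule: infinite_finite_induct)
  case (insert k X)
  then show ?case by (simp add: psd_on_add)
qed (simp_all add: psd_on_def quad_form_def)

lemma psd_on_scale:
  assumes "psd_on I A" "0 \<le> c"
  shows "psd_on I (\<lambda>p q. c * A p q)"
proof (rule psd_onI)
  fix v
  have "quad_form I (\<lambda>p q. c * A p q) v = c * quad_form I A v"
    by (simp add: quad_form_def sum_distrib_left mult_ac)
  then show "0 \<le> quad_form I (\<lambda>p q. c * A p q) v"
    using assms by (simp add: psd_onD)
qed

lemma psd_on_transpose_iff: "psd_on I (\<lambda>p q. A q p) \<longleftrightarrow> psd_on I A"
proof -
  have transpose: "psd_on I (\<lambda>p q. A q p)" if "psd_on I A" for A :: "'a kernel"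
  proof (rule psd_onI)
    fix v
    have "quad_form I (\<lambda>p q. A q p) v = quad_form I A (\<lambda>i. cnj (v i))"
      unfolding quad_form_def by (subst sum.swap) (simp add: mult_ac)
    then show "0 \<le> quad_form I (\<lambda>p q. A q p) v"
      using that by (simp add: psd_onD)
  qed
  show ?thesis
    using transpose[of A] transpose[of "\<lambda>p q. A q p"] by blast
qed

lemma psd_on_comp:
  assumes "psd_on I A" "finite I" "finite J" "f ` J \<subseteq> I"
  shows "psd_on J (\<lambda>p q. A (f p) (f q))"
proof (rule psd_onI)
  fix v :: "'b \<Rightarrow> complex"
  define w :: "'a \<Rightarrow> complex" where "w i = (\<Sum>p | p \<in> J \<and> f p = i. v p)" for i
  have "quad_form I A w = (\<Sum>i\<in>I. \<Sum>p | p \<in> J \<and> f p = i. \<Sum>j\<in>I. \<Sum>q | q \<in> J \<and> f q = j.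
      cnj (v p) * A (f p) (f q) * v q)"
    unfolding quad_form_def w_def cnj_sum sum_distrib_right unfolding sum_distrib_left
    by (intro sum.cong refl, subst sum.swap, rule sum.cong) auto
  also have "\<dots> = quad_form J (\<lambda>p q. A (f p) (f q)) v"
    unfolding quad_form_def sum.group[OF assms(3,2,4)] ..
  finally show "0 \<le> quad_form J (\<lambda>p q. A (f p) (f q)) v"
    using psd_onD[OF assms(1), of w] by simp
qed

lemma psd_on_bij_betw_iff:
  assumes "bij_betw f J I" "finite I"
  shows "psd_on J (\<lambda>p q. A (f p) (f q)) \<longleftrightarrow> psd_on I A"
proof
  assume "psd_on I A"
  then show "psd_on J (\<lambda>p q. A (f p) (f q))"
    using assms psd_on_comp[of I A J f] bij_betw_finite by (fastforce simp: bij_betw_def)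
next
  let ?g = "the_inv_into J f"
  assume "psd_on J (\<lambda>p q. A (f p) (f q))"
  moreover have "bij_betw ?g I J" using assms(1) by (rule bij_betw_the_inv_into)
  ultimately have "psd_on I (\<lambda>p q. A (f (?g p)) (f (?g q)))"
    using assms psd_on_comp[of J _ I ?g] bij_betw_finite by (fastforce simp: bij_betw_def)
  then show "psd_on I A"
    using assms(1) by (subst (asm) psd_on_cong) (auto simp: f_the_inv_into_f_bij_betw)
qed

lemma psd_on_subset:
  assumes "psd_on I A" "finite I" "J \<subseteq> I"
  shows "psd_on J A"
  using psd_on_comp[of I A J "\<lambda>p. p"] assms finite_subset by auto

lemma psd_on_diag_nonneg:
  assumes "psd_on I A" "finite I" "p \<in> I"
  shows "0 \<le> A p p"
  using psd_onD[OF psd_on_subset[OF assms(1,2), of "{p}"], of "\<lambda>_. 1"] assms(3)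
  by (simp add: quad_form_def)

lemma psd_on_two_points:
  assumes "psd_on I A" "finite I" "p \<in> I" "q \<in> I"
  shows "0 \<le> cnj a * A p p * a + cnj a * A p q * b + cnj b * A q p * a + cnj b * A q q * b"
proof -
  let ?f = "\<lambda>x. if x then p else q"
  have "psd_on UNIV (\<lambda>x y. A (?f x) (?f y))"
    using assms psd_on_comp[of I A UNIV ?f] by auto
  from psd_onD[OF this, of "\<lambda>x. if x then a else b"] show ?thesis
    by (simp add: quad_form_def UNIV_bool add.commute add.left_commute)
qed

lemma psd_on_hermitian_on:
  assumes "psd_on I A" "finite I"
  shows "hermitian_on I A"
  unfolding hermitian_on_def
proof (intro ballI)
  fix p q assume pq: "p \<in> I" "q \<in> I"
  have "Im (A p p) = 0" "Im (A q q) = 0"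
    using psd_on_diag_nonneg[OF assms] pq by (auto simp: less_eq_complex_def)
  then show "A q p = cnj (A p q)"
    using psd_on_two_points[OF assms pq, of 1 1] psd_on_two_points[OF assms pq, of 1 \<i>]
    by (simp add: complex_eq_iff less_eq_complex_def)
qed

lemma psd_on_norm_le:
  assumes "psd_on I A" "finite I" "p \<in> I" "q \<in> I"
    and diag_le: "\<And>r. r \<in> I \<Longrightarrow> A r r \<le> of_real c"
  shows "cmod (A p q) \<le> c"
proof -
  define r e where "r = cmod (A p q)" and "e = cis (Arg (A p q))"
  have pq: "A p q = of_real r * e"
    using rcis_cmod_Arg[of "A p q"] by (simp add: r_def e_def rcis_def)
  have qp: "A q p = of_real r * cnj e"
    using hermitian_onD[OF psd_on_hermitian_on[OF assms(1,2)] assms(3,4)] pq by simp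
  have phase: "e * (cnj e * z) = z" for z
    by (simp add: e_def cis_cnj cis_mult flip: mult.assoc)
  have "cnj 1 * A p p * 1 + cnj 1 * A p q * - cnj e + cnj (- cnj e) * A q p * 1
      + cnj (- cnj e) * A q q * - cnj e = A p p + A q q - 2 * of_real r"
    unfolding pq qp by (simp add: phase algebra_simps)
  with psd_on_two_points[OF assms(1-4), of 1 "- cnj e"]
  have "0 \<le> A p p + A q q - 2 * of_real r" by (simp only:)
  then show ?thesis
    using diag_le[OF assms(3)] diag_le[OF assms(4)] by (simp add: less_eq_complex_def r_def)
qed

lemma psd_on_zero_diag:
  assumes "psd_on I A" "finite I" "p \<in> I" "q \<in> I" "A p p = 0"
  shows "A p q = 0"
proof (rule ccontr)
  assume "A p q \<noteq> 0"
  define c :: real where "c = (Re (A q q) + 1) / (cmod (A p q))\<^sup>2"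
  have "A q p = cnj (A p q)"
    using hermitian_onD[OF psd_on_hermitian_on[OF assms(1,2)] assms(3,4)] .
  with psd_on_two_points[OF assms(1-4), of "- of_real c * A p q" 1]
  have "0 \<le> Re (- of_real c * cnj (A p q) * A p q - cnj (A p q) * (of_real c * A p q) + A q q)"
    using assms(5) by (simp add: less_eq_complex_def)
  also have "\<dots> = - 2 * (c * (cmod (A p q))\<^sup>2) + Re (A q q)"
    unfolding cmod_power2 by (simp add: power2_eq_square algebra_simps)
  also have "c * (cmod (A p q))\<^sup>2 = Re (A q q) + 1"
    using \<open>A p q \<noteq> 0\<close> by (simp add: c_def)
  finally show False
    using psd_on_diag_nonneg[OF assms(1,2,4)] by (simp add: less_eq_complex_def)
qed

lemma quad_form_update:
  assumes "finite I" "x \<in> I"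
  shows "quad_form I A (v(x := v x + c)) = quad_form I A v + cnj c * (\<Sum>j\<in>I. A x j * v j)
    + (\<Sum>i\<in>I. cnj (v i) * A i x) * c + cnj c * A x x * c"
proof -
  have "cnj ((v(x := v x + c)) i) * A i j * (v(x := v x + c)) j = cnj (v i) * A i j * v j
      + of_bool (i = x) * (cnj c * (A x j * v j)) + of_bool (j = x) * (cnj (v i) * A i x * c)
      + of_bool (i = x) * (of_bool (j = x) * (cnj c * A x x * c))" for i j
    by (auto simp: algebra_simps)
  then show ?thesis
    using assms
    by (simp add: quad_form_def sum.distrib del: fun_upd_apply
        flip: sum_distrib_left sum_distrib_right)
qed

text \<open>Completing the square at the pivot \<open>x\<close>. Since division by zero gives zero, \<open>A x x = 0\<close> needs
  no separate treatment.\<close>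

lemma psd_on_eliminate:
  assumes A: "psd_on I A" and fin: "finite I" and x: "x \<in> I"
  obtains u where "\<And>i. i \<in> I \<Longrightarrow> A i x = rank_one_kernel u i x"
    "psd_on I (\<lambda>p q. A p q - rank_one_kernel u p q)"
proof
  define s where "s = complex_of_real (sqrt (Re (A x x)))"
  define u where "u i = A i x / s" for i
  have "0 \<le> A x x" using psd_on_diag_nonneg[OF A fin x] .
  then have s: "s * s = A x x" "cnj s = s"
    by (simp_all add: s_def less_eq_complex_def complex_eq_iff)
  have herm: "cnj (A i x) = A x i" if "i \<in> I" for i
    using hermitian_onD[OF psd_on_hermitian_on[OF A fin] that x] by simp
  have zero: "A x i = 0" if "i \<in> I" "s = 0" for i
    using psd_on_zero_diag[OF A fin x that(1)] that(2) s by simp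
  show "A i x = rank_one_kernel u i x" if "i \<in> I" for i
    using s herm[OF x] herm[OF that] zero[OF that]
    by (cases "s = 0") (auto simp: u_def rank_one_kernel_def)
  show "psd_on I (\<lambda>p q. A p q - rank_one_kernel u p q)"
  proof (rule psd_onI)
    fix v
    define r where "r = (\<Sum>j\<in>I. A x j * v j)"
    have cnj_r: "(\<Sum>i\<in>I. cnj (v i) * A i x) = cnj r"
      unfolding r_def cnj_sum by (intro sum.cong refl) (simp add: herm[symmetric] mult.commute)
    have "r = 0" if "s = 0" using zero that by (simp add: r_def)
    then have "quad_form I A (v(x := v x + - r / A x x)) = quad_form I A v - cnj r / s * (r / s)"
      unfolding quad_form_update[OF fin x] cnj_r r_def[symmetric] s(1)[symmetric]
      by (cases "s = 0") (simp_all add: s(2) field_simps)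
    also have "r / s = (\<Sum>j\<in>I. cnj (u j) * v j)"
      by (simp add: r_def u_def s(2) herm sum_divide_distrib)
    also have "cnj r / s = (\<Sum>i\<in>I. cnj (v i) * u i)"
      by (simp add: u_def sum_divide_distrib flip: cnj_r)
    also have "quad_form I A v - (\<Sum>i\<in>I. cnj (v i) * u i) * (\<Sum>j\<in>I. cnj (u j) * v j)
        = quad_form I (\<lambda>p q. A p q - rank_one_kernel u p q) v"
      by (simp add: quad_form_def rank_one_kernel_def sum_product sum_subtractf algebra_simps)
    finally show "0 \<le> quad_form I (\<lambda>p q. A p q - rank_one_kernel u p q) v"
      using psd_onD[OF A] by metis
  qed
qed

lemma psd_on_imp_sum_rank_one:
  assumes "finite I" "psd_on I A"
  shows "\<exists>w. \<forall>p\<in>I. \<forall>q\<in>I. A p q = (\<Sum>k\<in>I. rank_one_kernel (w k) p q)"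
  using assms
proof (induction I arbitrary: A rule: finite_induct)
  case empty
  then show ?case by simp
next
  case (insert x F)
  have fin: "finite (insert x F)" using insert.hyps by simp
  obtain u where u: "\<And>i. i \<in> insert x F \<Longrightarrow> A i x = rank_one_kernel u i x"
    and rest: "psd_on (insert x F) (\<lambda>p q. A p q - rank_one_kernel u p q)"
    using psd_on_eliminate[OF insert.prems fin insertI1] by blast
  have "psd_on F (\<lambda>p q. A p q - rank_one_kernel u p q)"
    using psd_on_subset[OF rest fin] by blast
  from insert.IH[OF this] obtain w where
    w: "\<And>p q. p \<in> F \<Longrightarrow> q \<in> F \<Longrightarrow>
      A p q - rank_one_kernel u p q = (\<Sum>k\<in>F. rank_one_kernel (w k) p q)"
    by blast
  have u': "A x i = rank_one_kernel u x i" if "i \<in> insert x F" for i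
    using hermitian_onD[OF psd_on_hermitian_on[OF insert.prems fin] that insertI1] u[OF that]
    by (simp add: rank_one_kernel_def)
  define W where "W k = (if k = x then u else (w k)(x := 0))" for k
  have "A p q = (\<Sum>k\<in>insert x F. rank_one_kernel (W k) p q)"
    if p: "p \<in> insert x F" and q: "q \<in> insert x F" for p q
  proof -
    have "(\<Sum>k\<in>F. rank_one_kernel (W k) p q) = (\<Sum>k\<in>F. rank_one_kernel ((w k)(x := 0)) p q)"
      using insert.hyps by (intro sum.cong) (auto simp: W_def)
    also have "\<dots> = A p q - rank_one_kernel u p q"
      using p q w[of p q] u[of p] u'[of q]
      by (cases "p = x \<or> q = x") (auto simp: rank_one_kernel_def)
    finally show ?thesis using insert.hyps by (simp add: W_def)
  qed
  then show ?case by blast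
qed

section \<open>The link product\<close>

text \<open>On Choi kernels the link product is composition of channels; with an operator on the left it
  applies the channel to the second tensor factor.\<close>

definition link_product ::
  "'b set \<Rightarrow> ('a \<times> 'b) kernel \<Rightarrow> ('b \<times> 'c) kernel \<Rightarrow> ('a \<times> 'c) kernel" where
  "link_product T X Y = (\<lambda>(a, c) (a', c'). \<Sum>b\<in>T. \<Sum>b'\<in>T. X (a, b) (a', b') * Y (b, c) (b', c'))"

lemma link_product_apply [simp]:
  "link_product T X Y (a, c) (a', c') = (\<Sum>b\<in>T. \<Sum>b'\<in>T. X (a, b) (a', b') * Y (b, c) (b', c'))"
  by (simp add: link_product_def)

lemma link_product_cong:
  assumes "p \<in> A \<times> C" "q \<in> A \<times> C"
    and "\<And>p q. p \<in> A \<times> T \<Longrightarrow> q \<in> A \<times> T \<Longrightarrow> X p q = X' p q"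
    and "\<And>p q. p \<in> T \<times> C \<Longrightarrow> q \<in> T \<times> C \<Longrightarrow> Y p q = Y' p q"
  shows "link_product T X Y p q = link_product T X' Y' p q"
  using assms by (auto intro!: sum.cong)

lemma link_product_assoc:
  "link_product U (link_product T X Y) Z = link_product T X (link_product U Y Z)"
proof (intro ext, clarify)
  fix a d a' d'
  have "(\<Sum>c\<in>U. \<Sum>c'\<in>U. \<Sum>b\<in>T. \<Sum>b'\<in>T. X (a, b) (a', b') * Y (b, c) (b', c') * Z (c, d) (c', d'))
      = (\<Sum>b\<in>T. \<Sum>b'\<in>T. \<Sum>c\<in>U. \<Sum>c'\<in>U. X (a, b) (a', b') * Y (b, c) (b', c') * Z (c, d) (c', d'))"
    unfolding sum.cartesian_product
    by (rule sum.reindex_bij_witness[where i = "\<lambda>(b, b', c, c'). (c, c', b, b')"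
          and j = "\<lambda>(c, c', b, b'). (b, b', c, c')"]) auto
  then show "link_product U (link_product T X Y) Z (a, d) (a', d')
      = link_product T X (link_product U Y Z) (a, d) (a', d')"
    by (simp add: sum_distrib_left sum_distrib_right mult.assoc)
qed

lemma link_product_sum_left:
  "link_product T (\<lambda>p q. \<Sum>k\<in>I. X k p q) Y p q = (\<Sum>k\<in>I. link_product T (X k) Y p q)"
  by (cases p; cases q) (simp add: sum_distrib_right sum.swap[where B = I])

lemma link_product_sum_right:
  "link_product T X (\<lambda>p q. \<Sum>k\<in>I. Y k p q) p q = (\<Sum>k\<in>I. link_product T X (Y k) p q)"
  by (cases p; cases q) (simp add: sum_distrib_left sum.swap[where B = I])

lemma link_product_scale_left:
  "link_product T (\<lambda>p q. c * X p q) Y p q = c * link_product T X Y p q"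
  by (cases p; cases q) (simp add: sum_distrib_left mult.assoc)

lemma link_product_scale_right:
  "link_product T X (\<lambda>p q. c * Y p q) p q = c * link_product T X Y p q"
  by (cases p; cases q) (simp add: sum_distrib_left mult.left_commute)

lemma link_product_convex_right:
  "link_product S A (\<lambda>p q. of_real (1 - c) * X p q + of_real c * Y p q) p q
    = (1 - c) *\<^sub>R link_product S A X p q + c *\<^sub>R link_product S A Y p q"
  by (cases p; cases q)
    (simp add: scaleR_conv_of_real sum.distrib sum_distrib_left distrib_left mult.left_commute
      del: of_real_diff)

lemma link_product_rank_one:
  "link_product T (rank_one_kernel u) (rank_one_kernel v)
    = rank_one_kernel (\<lambda>(a, c). \<Sum>b\<in>T. u (a, b) * v (b, c))"
  by (auto simp: fun_eq_iff rank_one_kernel_def sum_product mult_ac)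

lemma hermitian_on_link_product:
  assumes X: "hermitian_on (A \<times> T) X" and Y: "hermitian_on (T \<times> C) Y"
  shows "hermitian_on (A \<times> C) (link_product T X Y)"
  unfolding hermitian_on_def
proof clarify
  fix a c a' c' assume "a \<in> A" "c \<in> C" "a' \<in> A" "c' \<in> C"
  then have "X (a', b) (a, b') * Y (b, c') (b', c) = cnj (X (a, b') (a', b) * Y (b', c) (b, c'))"
    if "b \<in> T" "b' \<in> T" for b b'
    using hermitian_onD[OF X, of "(a, b')" "(a', b)"] hermitian_onD[OF Y, of "(b', c)" "(b, c')"]
      that by simp
  then have "link_product T X Y (a', c') (a, c)
      = (\<Sum>b\<in>T. \<Sum>b'\<in>T. cnj (X (a, b') (a', b) * Y (b', c) (b, c')))"
    by (simp cong: sum.cong)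
  also have "\<dots> = cnj (link_product T X Y (a, c) (a', c'))"
    by (subst sum.swap) simp
  finally show "link_product T X Y (a', c') (a, c) = cnj (link_product T X Y (a, c) (a', c'))" .
qed

lemma quad_form_link_product_rank_one:
  "quad_form (A \<times> C) (link_product T X (rank_one_kernel w)) v
    = quad_form (A \<times> T) X (\<lambda>(a, b). \<Sum>c\<in>C. cnj (w (b, c)) * v (a, c))"
proof -
  let ?f = "\<lambda>a b c a' b' c'.
    cnj (v (a, c)) * w (b, c) * X (a, b) (a', b') * cnj (w (b', c')) * v (a', c')"
  have "quad_form (A \<times> C) (link_product T X (rank_one_kernel w)) v
      = (\<Sum>a\<in>A. \<Sum>c\<in>C. \<Sum>a'\<in>A. \<Sum>c'\<in>C. \<Sum>b\<in>T. \<Sum>b'\<in>T. ?f a b c a' b' c')"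
    unfolding quad_form_def sum.cartesian_product' rank_one_kernel_def
    by (simp add: sum_distrib_left sum_distrib_right mult_ac)
  also have "\<dots> = (\<Sum>a\<in>A. \<Sum>b\<in>T. \<Sum>a'\<in>A. \<Sum>b'\<in>T. \<Sum>c\<in>C. \<Sum>c'\<in>C. ?f a b c a' b' c')"
    unfolding sum.cartesian_product
    by (rule sum.reindex_bij_witness[where i = "\<lambda>(a, b, a', b', c, c'). (a, c, a', c', b, b')"
          and j = "\<lambda>(a, c, a', c', b, b'). (a, b, a', b', c, c')"]) auto
  also have "\<dots> = quad_form (A \<times> T) X (\<lambda>(a, b). \<Sum>c\<in>C. cnj (w (b, c)) * v (a, c))"
    unfolding quad_form_def sum.cartesian_product'
    by (simp add: sum_distrib_left sum_distrib_right mult_ac)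
  finally show ?thesis .
qed

lemma psd_on_link_product:
  assumes "finite T" "finite C" and X: "psd_on (A \<times> T) X" and Y: "psd_on (T \<times> C) Y"
  shows "psd_on (A \<times> C) (link_product T X Y)"
proof -
  obtain w where w: "\<And>p q. p \<in> T \<times> C \<Longrightarrow> q \<in> T \<times> C \<Longrightarrow>
      Y p q = (\<Sum>k\<in>T \<times> C. rank_one_kernel (w k) p q)"
    using psd_on_imp_sum_rank_one[OF _ Y] assms(1,2) by blast
  have "psd_on (A \<times> C) (\<lambda>p q. \<Sum>k\<in>T \<times> C. link_product T X (rank_one_kernel (w k)) p q)"
    using X by (intro psd_on_sum psd_onI) (simp add: quad_form_link_product_rank_one psd_onD)
  also have "?this \<longleftrightarrow> ?thesis"
    unfolding link_product_sum_right[symmetric]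
    by (intro psd_on_cong link_product_cong[of _ A C]) (simp_all add: w)
  finally show ?thesis .
qed

definition identity_kernel :: "('a \<times> 'a) kernel" where
  "identity_kernel = (\<lambda>(a, b) (a', b'). of_bool (a = b) * of_bool (a' = b'))"

lemma sum_sum_mult_of_bool_eq:
  fixes f :: "'a \<Rightarrow> 'b \<Rightarrow> 'c :: comm_semiring_1"
  assumes "finite A" "finite B" "a \<in> A" "b \<in> B"
  shows "(\<Sum>x\<in>A. \<Sum>y\<in>B. of_bool (x = a) * of_bool (y = b) * f x y) = f a b"
proof -
  have "(\<Sum>y\<in>B. of_bool (x = a) * of_bool (y = b) * f x y) = of_bool (x = a) * f x b" for x
    using assms by (cases "x = a") simp_all
  then show ?thesis using assms by simp
qed

lemma rank_one_kernel_eq_identity_kernel: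
  "rank_one_kernel (\<lambda>(a, b). of_bool (a = b)) = identity_kernel"
  by (auto simp: fun_eq_iff identity_kernel_def rank_one_kernel_def)

lemma link_product_identity_right:
  assumes "finite T" "p \<in> A \<times> T" "q \<in> A \<times> T"
  shows "link_product T X identity_kernel p q = X p q"
  using assms by (auto simp: identity_kernel_def sum_sum_mult_of_bool_eq mult.commute[of "X _ _"])

lemma link_product_identity_left:
  assumes "finite T" "p \<in> T \<times> C" "q \<in> T \<times> C"
  shows "link_product T identity_kernel X p q = X p q"
proof -
  obtain b c b' c' where "p = (b, c)" "q = (b', c')" "b \<in> T" "b' \<in> T"
    using assms by auto
  then show ?thesis
    using \<open>finite T\<close>
    by (simp add: identity_kernel_def sum_sum_mult_of_bool_eq eq_commute[of b] eq_commute[of b'])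
qed

definition kernel_trace :: "'a set \<Rightarrow> 'a kernel \<Rightarrow> 'a kernel \<Rightarrow> complex" where
  "kernel_trace I X Y = (\<Sum>p\<in>I. \<Sum>q\<in>I. X p q * Y q p)"

lemma kernel_trace_cong:
  assumes "\<And>p q. p \<in> I \<Longrightarrow> q \<in> I \<Longrightarrow> X p q = X' p q" "\<And>p q. p \<in> I \<Longrightarrow> q \<in> I \<Longrightarrow> Y p q = Y' p q"
  shows "kernel_trace I X Y = kernel_trace I X' Y'"
  unfolding kernel_trace_def using assms by (intro sum.cong refl) simp

lemma kernel_trace_sum_right:
  "kernel_trace I X (\<lambda>p q. \<Sum>k\<in>K. Y k p q) = (\<Sum>k\<in>K. kernel_trace I X (Y k))"
  by (simp add: kernel_trace_def sum_distrib_left sum.swap[where B = K])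

definition adjoint_kernel :: "('a \<times> 'b) kernel \<Rightarrow> ('b \<times> 'a) kernel" where
  "adjoint_kernel U = (\<lambda>(b, a) (b', a'). U (a', b') (a, b))"

lemma kernel_trace_link_product:
  "kernel_trace (N \<times> T) G (link_product B X U)
    = kernel_trace (N \<times> B) (link_product T G (adjoint_kernel U)) X"
proof -
  let ?f = "\<lambda>m t n s b c. G (m, t) (n, s) * (X (n, b) (m, c) * U (b, s) (c, t))"
  have "kernel_trace (N \<times> T) G (link_product B X U)
      = (\<Sum>m\<in>N. \<Sum>t\<in>T. \<Sum>n\<in>N. \<Sum>s\<in>T. \<Sum>b\<in>B. \<Sum>c\<in>B. ?f m t n s b c)"
    unfolding kernel_trace_def sum.cartesian_product' by (simp add: sum_distrib_left)
  also have "\<dots> = (\<Sum>m\<in>N. \<Sum>c\<in>B. \<Sum>n\<in>N. \<Sum>b\<in>B. \<Sum>t\<in>T. \<Sum>s\<in>T. ?f m t n s b c)"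
    unfolding sum.cartesian_product
    by (rule sum.reindex_bij_witness[where i = "\<lambda>(m, c, n, b, t, s). (m, t, n, s, b, c)"
          and j = "\<lambda>(m, t, n, s, b, c). (m, c, n, b, t, s)"]) auto
  also have "\<dots> = kernel_trace (N \<times> B) (link_product T G (adjoint_kernel U)) X"
    unfolding kernel_trace_def sum.cartesian_product'
    by (simp add: adjoint_kernel_def sum_distrib_left sum_distrib_right mult_ac)
  finally show ?thesis .
qed

lemma hermitian_on_adjoint_kernel:
  assumes "hermitian_on (A \<times> B) U"
  shows "hermitian_on (B \<times> A) (adjoint_kernel U)"
  unfolding hermitian_on_def
proof clarify
  fix b a b' a' assume "a \<in> A" "b \<in> B" "a' \<in> A" "b' \<in> B"
  then show "adjoint_kernel U (b', a') (b, a) = cnj (adjoint_kernel U (b, a) (b', a'))"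
    using hermitian_onD[OF assms, of "(a', b')" "(a, b)"] by (simp add: adjoint_kernel_def)
qed

lemma Re_kernel_trace_hermitian:
  assumes "hermitian_on I G"
  shows "Re (kernel_trace I G X) = (\<Sum>p\<in>I. \<Sum>q\<in>I. inner (G p q) (X p q))"
proof -
  have "Re (kernel_trace I G X) = (\<Sum>p\<in>I. \<Sum>q\<in>I. Re (G q p * X p q))"
    unfolding kernel_trace_def by (subst sum.swap) simp
  also have "\<dots> = (\<Sum>p\<in>I. \<Sum>q\<in>I. inner (G p q) (X p q))"
  proof (intro sum.cong refl)
    fix p q assume "p \<in> I" "q \<in> I"
    from hermitian_onD[OF assms this] show "Re (G q p * X p q) = inner (G p q) (X p q)"
      by (simp add: inner_complex_def)
  qed
  finally show ?thesis .
qed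

section \<open>Channels and measurements\<close>

definition channel_kernel :: "'a set \<Rightarrow> 'b set \<Rightarrow> ('a \<times> 'b) kernel \<Rightarrow> bool" where
  "channel_kernel S T C \<longleftrightarrow> psd_on (S \<times> T) C \<and>
     (\<forall>s\<in>S. \<forall>s'\<in>S. (\<Sum>t\<in>T. C (s, t) (s', t)) = of_bool (s = s'))"

lemma channel_kernel_cong:
  assumes "\<And>p q. p \<in> S \<times> T \<Longrightarrow> q \<in> S \<times> T \<Longrightarrow> C p q = C' p q"
  shows "channel_kernel S T C \<longleftrightarrow> channel_kernel S T C'"
  using psd_on_cong[of "S \<times> T" C C'] assms by (simp add: channel_kernel_def cong: sum.cong)

lemma sum_link_product_channel_kernel:
  assumes "finite B" and U: "channel_kernel B T U"
  shows "(\<Sum>t\<in>T. link_product B X U (a, t) (a', t)) = (\<Sum>b\<in>B. X (a, b) (a', b))"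
proof -
  have "(\<Sum>t\<in>T. link_product B X U (a, t) (a', t))
      = (\<Sum>b\<in>B. \<Sum>b'\<in>B. \<Sum>t\<in>T. X (a, b) (a', b') * U (b, t) (b', t))"
    unfolding link_product_apply by (subst sum.swap, subst (2) sum.swap) (rule refl)
  also have "\<dots> = (\<Sum>b\<in>B. \<Sum>b'\<in>B. X (a, b) (a', b') * of_bool (b = b'))"
    using U by (intro sum.cong refl) (simp add: channel_kernel_def flip: sum_distrib_left)
  also have "\<dots> = (\<Sum>b\<in>B. X (a, b) (a', b))"
    using \<open>finite B\<close> by simp
  finally show ?thesis .
qed

lemma channel_kernel_depolarizing:
  assumes "finite S" "finite T" "T \<noteq> {}"
  shows "channel_kernel S T (\<lambda>p q. of_real (1 / real (card T)) * of_bool (p = q))"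
proof -
  have "psd_on (S \<times> T) (\<lambda>p q. of_real (1 / real (card T)) * of_bool (p = q))"
    using assms by (intro psd_on_scale psd_on_of_bool_eq) (simp_all add: less_eq_complex_def)
  then show ?thesis
    using assms by (simp add: channel_kernel_def)
qed

lemma channel_kernel_norm_le:
  assumes fin: "finite S" "finite T" and C: "channel_kernel S T C"
    and "p \<in> S \<times> T" "q \<in> S \<times> T"
  shows "cmod (C p q) \<le> 1"
proof -
  have psd: "psd_on (S \<times> T) C" using C by (simp add: channel_kernel_def)
  have "C r r \<le> 1" if r: "r \<in> S \<times> T" for r
  proof -
    obtain s t where st: "r = (s, t)" "s \<in> S" "t \<in> T" using r by auto
    have "C (s, t) (s, t) \<le> (\<Sum>t\<in>T. C (s, t) (s, t))"
      using psd_on_diag_nonneg[OF psd] fin st by (intro member_le_sum) auto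
    also have "\<dots> = 1" using C st by (simp add: channel_kernel_def)
    finally show ?thesis using st by simp
  qed
  then show ?thesis
    using psd_on_norm_le[OF psd, of p q 1] assms by simp
qed

lemma channel_kernel_convex:
  assumes "channel_kernel S T C" "channel_kernel S T C'" "0 \<le> c" "c \<le> 1"
  shows "channel_kernel S T (\<lambda>p q. of_real (1 - c) * C p q + of_real c * C' p q)"
proof -
  have "psd_on (S \<times> T) (\<lambda>p q. of_real (1 - c) * C p q + of_real c * C' p q)"
    using assms
    by (intro psd_on_add psd_on_scale) (auto simp: channel_kernel_def less_eq_complex_def)
  then show ?thesis
    using assms unfolding channel_kernel_def by (auto simp: sum.distrib simp flip: sum_distrib_left)
qed

definition povm_on :: "'a set \<Rightarrow> nat \<Rightarrow> (nat \<Rightarrow> 'a kernel) \<Rightarrow> bool" where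
  "povm_on I k P \<longleftrightarrow> (\<forall>i<k. psd_on I (P i)) \<and>
     (\<forall>p\<in>I. \<forall>q\<in>I. (\<Sum>i<k. P i p q) = of_bool (p = q))"

lemma povm_on_cong:
  assumes "\<And>i p q. i < k \<Longrightarrow> p \<in> I \<Longrightarrow> q \<in> I \<Longrightarrow> P i p q = Q i p q"
  shows "povm_on I k P \<longleftrightarrow> povm_on I k Q"
  using psd_on_cong[of I "P _" "Q _"] assms by (simp add: povm_on_def)

lemma povm_on_norm_le:
  assumes "finite I" and P: "povm_on I k P" and "i < k" "p \<in> I" "q \<in> I"
  shows "cmod (P i p q) \<le> 1"
proof -
  have psd: "psd_on I (P j)" if "j < k" for j using P that by (simp add: povm_on_def)
  have "P i r r \<le> 1" if "r \<in> I" for r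
  proof -
    have "P i r r \<le> (\<Sum>j<k. P j r r)"
      using psd_on_diag_nonneg[OF psd \<open>finite I\<close> that] \<open>i < k\<close> by (intro member_le_sum) auto
    also have "\<dots> = 1" using P that by (simp add: povm_on_def)
    finally show ?thesis .
  qed
  then show ?thesis
    using psd_on_norm_le[OF psd[OF \<open>i < k\<close>], of p q 1] assms by simp
qed

lemma povm_on_uniform:
  assumes "finite I" "k \<ge> 1"
  shows "povm_on I k (\<lambda>_ p q. of_real (1 / real k) * of_bool (p = q))"
proof -
  have "psd_on I (\<lambda>p q. of_real (1 / real k) * of_bool (p = q))"
    using assms by (intro psd_on_scale psd_on_of_bool_eq) (simp_all add: less_eq_complex_def)
  then show ?thesis
    using assms by (simp add: povm_on_def)
qed

lemma povm_on_link_product: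
  assumes fin: "finite T" "finite A" and C: "channel_kernel S T C" and P: "povm_on (T \<times> A) k P"
  shows "povm_on (S \<times> A) k (\<lambda>i. link_product T C (P i))"
proof -
  have "psd_on (S \<times> A) (link_product T C (P i))" if "i < k" for i
    using C P that fin by (intro psd_on_link_product) (auto simp: channel_kernel_def povm_on_def)
  moreover have "(\<Sum>i<k. link_product T C (P i) (s, a) (s', a')) = of_bool ((s, a) = (s', a'))"
    if "s \<in> S" "a \<in> A" "s' \<in> S" "a' \<in> A" for s a s' a'
  proof -
    have "(\<Sum>i<k. link_product T C (P i) (s, a) (s', a'))
        = (\<Sum>t\<in>T. \<Sum>t'\<in>T. C (s, t) (s', t') * of_bool ((t, a) = (t', a')))"
      using P that unfolding link_product_sum_right[symmetric]
      by (auto simp: povm_on_def intro!: sum.cong)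
    also have "\<dots> = of_bool (a = a') * (\<Sum>t\<in>T. C (s, t) (s', t))"
      using fin by (cases "a = a'") simp_all
    also have "\<dots> = of_bool ((s, a) = (s', a'))"
      using C that by (auto simp: channel_kernel_def)
    finally show ?thesis .
  qed
  ultimately show ?thesis by (auto simp: povm_on_def)
qed

text \<open>A channel built from shared entanglement and classical communication: measure \<open>P\<close> on the input
  and one half of \<open>\<rho>\<close>, then correct the other half by the channel \<open>U i\<close> named by the outcome.\<close>

definition measure_and_correct :: "'b set \<Rightarrow> 'c set \<Rightarrow> nat \<Rightarrow> (nat \<Rightarrow> ('a \<times> 'b) kernel) \<Rightarrow>
    ('b \<times> 'c) kernel \<Rightarrow> (nat \<Rightarrow> ('c \<times> 'd) kernel) \<Rightarrow> ('a \<times> 'd) kernel" where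
  "measure_and_correct A B k P \<rho> U =
    (\<lambda>p q. \<Sum>i<k. link_product B (link_product A (P i) \<rho>) (U i) p q)"

lemma measure_and_correct_cong:
  assumes "p \<in> S \<times> T" "q \<in> S \<times> T"
    and "\<And>i p q. i < k \<Longrightarrow> p \<in> S \<times> A \<Longrightarrow> q \<in> S \<times> A \<Longrightarrow> P i p q = P' i p q"
    and "\<And>p q. p \<in> A \<times> B \<Longrightarrow> q \<in> A \<times> B \<Longrightarrow> \<rho> p q = \<rho>' p q"
  shows "measure_and_correct A B k P \<rho> U p q = measure_and_correct A B k P' \<rho>' U p q"
  unfolding measure_and_correct_def
  by (intro sum.cong refl link_product_cong[OF assms(1,2)] link_product_cong[of _ S B])
    (simp_all add: assms(3,4))

lemma channel_kernel_measure_and_correct: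
  assumes fin: "finite A" "finite B" "finite T"
    and P: "povm_on (S \<times> A) k P"
    and \<rho>: "psd_on (A \<times> B) \<rho>" "(\<Sum>p\<in>A \<times> B. \<rho> p p) = 1"
    and U: "\<And>i. i < k \<Longrightarrow> channel_kernel B T (U i)"
  shows "channel_kernel S T (measure_and_correct A B k P \<rho> U)"
proof -
  let ?prepared = "\<lambda>i. link_product A (P i) \<rho>"
  have "psd_on (S \<times> T) (link_product B (?prepared i) (U i))" if "i < k" for i
    using P U[OF that] that \<rho>(1) fin
    by (intro psd_on_link_product) (auto simp: povm_on_def channel_kernel_def)
  then have "psd_on (S \<times> T) (measure_and_correct A B k P \<rho> U)"
    unfolding measure_and_correct_def by (intro psd_on_sum) simp
  moreover have "(\<Sum>t\<in>T. measure_and_correct A B k P \<rho> U (s, t) (s', t)) = of_bool (s = s')"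
    if "s \<in> S" "s' \<in> S" for s s'
  proof -
    have "(\<Sum>t\<in>T. measure_and_correct A B k P \<rho> U (s, t) (s', t))
        = (\<Sum>i<k. \<Sum>b\<in>B. ?prepared i (s, b) (s', b))"
      unfolding measure_and_correct_def using U
      by (subst sum.swap) (simp add: sum_link_product_channel_kernel fin del: link_product_apply)
    also have "\<dots> = (\<Sum>b\<in>B. link_product A (\<lambda>p q. \<Sum>i<k. P i p q) \<rho> (s, b) (s', b))"
      by (subst sum.swap) (simp only: link_product_sum_left)
    also have "\<dots> = (\<Sum>b\<in>B. \<Sum>a\<in>A. \<Sum>a'\<in>A. of_bool ((s, a) = (s', a')) * \<rho> (a, b) (a', b))"
      using P that by (auto simp: povm_on_def intro!: sum.cong)
    also have "\<dots> = of_bool (s = s') * (\<Sum>b\<in>B. \<Sum>a\<in>A. \<rho> (a, b) (a, b))"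
      using fin by (cases "s = s'") simp_all
    also have "(\<Sum>b\<in>B. \<Sum>a\<in>A. \<rho> (a, b) (a, b)) = 1"
      using \<rho>(2) by (subst sum.swap) (simp add: sum.cartesian_product')
    finally show ?thesis by simp
  qed
  ultimately show ?thesis by (simp add: channel_kernel_def)
qed

definition degrades_to ::
  "'n set \<Rightarrow> 's set \<Rightarrow> 't set \<Rightarrow> ('n \<times> 's) kernel \<Rightarrow> ('n \<times> 't) kernel \<Rightarrow> bool" where
  "degrades_to N S T \<Phi> \<Psi> \<longleftrightarrow> (\<exists>C. channel_kernel S T C \<and>
     (\<forall>p\<in>N \<times> T. \<forall>q\<in>N \<times> T. \<Psi> p q = link_product S \<Phi> C p q))"

section \<open>Separation from the images under channels\<close>

lemma compact_Pi_UNIV: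
  fixes S :: "'i \<Rightarrow> 'b :: topological_space set"
  assumes "\<And>i. compact (S i)"
  shows "compact {f. \<forall>i. f i \<in> S i}"
proof -
  have "compactin (product_topology (\<lambda>i. euclidean) UNIV) (PiE UNIV S)"
    using assms by (simp add: compactin_PiE)
  also have "PiE UNIV S = {f. \<forall>i. f i \<in> S i}"
    by (auto simp: PiE_def Pi_def)
  finally show ?thesis by (simp add: euclidean_product_topology)
qed

lemma continuous_on_kernel_entry: "continuous_on X (\<lambda>K. K p q :: complex)"
  by (rule continuous_on_subset[of UNIV]) (auto intro: continuous_on_product_then_coordinatewise)

lemma compact_channel_kernels:
  "compact {C. channel_kernel S T C \<and> (\<forall>p q. cmod (C p q) \<le> 1)}"
proof -
  have "compact {C :: ('a \<times> 'b) kernel. \<forall>p. C p \<in> {g. \<forall>q. g q \<in> cball 0 1}}"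
    by (intro compact_Pi_UNIV compact_cball)
  moreover have "closed {C. psd_on (S \<times> T) C}"
    unfolding psd_on_def quad_form_def less_eq_complex_def
    by (intro closed_Collect_all closed_Collect_conj closed_Collect_le closed_Collect_eq
        continuous_intros continuous_on_kernel_entry)
  moreover have "closed {C. \<forall>s\<in>S. \<forall>s'\<in>S. (\<Sum>t\<in>T. C (s, t) (s', t) :: complex) = of_bool (s = s')}"
    unfolding Ball_def
    by (intro closed_Collect_all closed_Collect_imp closed_Collect_eq
        continuous_intros continuous_on_kernel_entry) auto
  ultimately have "compact ({C :: ('a \<times> 'b) kernel. \<forall>p. C p \<in> {g. \<forall>q. g q \<in> cball 0 1}} \<inter>
      ({C. psd_on (S \<times> T) C} \<inter>
        {C. \<forall>s\<in>S. \<forall>s'\<in>S. (\<Sum>t\<in>T. C (s, t) (s', t)) = of_bool (s = s')}))"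
    by (intro compact_Int_closed closed_Int)
  also have "\<dots> = {C. channel_kernel S T C \<and> (\<forall>p q. cmod (C p q) \<le> 1)}"
    by (auto simp: channel_kernel_def)
  finally show ?thesis .
qed

lemma sum_inner_closest_point_le:
  fixes x y z :: "'i \<Rightarrow> 'a :: real_inner"
  assumes closest: "\<And>c. 0 < c \<Longrightarrow> c \<le> 1 \<Longrightarrow>
    (\<Sum>i\<in>I. (norm (z i - x i))\<^sup>2) \<le> (\<Sum>i\<in>I. (norm (z i - ((1 - c) *\<^sub>R x i + c *\<^sub>R y i)))\<^sup>2)"
  shows "(\<Sum>i\<in>I. inner (z i - x i) (y i - x i)) \<le> 0"
proof -
  define slope where "slope = (\<Sum>i\<in>I. inner (z i - x i) (y i - x i))"
  define len where "len = (\<Sum>i\<in>I. (norm (y i - x i))\<^sup>2)"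
  have "(norm (z i - ((1 - c) *\<^sub>R x i + c *\<^sub>R y i)))\<^sup>2 = (norm (z i - x i))\<^sup>2
      - 2 * c * inner (z i - x i) (y i - x i) + c\<^sup>2 * (norm (y i - x i))\<^sup>2" for c i
    unfolding power2_norm_eq_inner
    by (simp add: inner_simps inner_commute power2_eq_square algebra_simps)
  then have expand: "(\<Sum>i\<in>I. (norm (z i - ((1 - c) *\<^sub>R x i + c *\<^sub>R y i)))\<^sup>2)
      = (\<Sum>i\<in>I. (norm (z i - x i))\<^sup>2) - 2 * c * slope + c\<^sup>2 * len" for c
    by (simp add: slope_def len_def sum.distrib sum_subtractf sum_distrib_left)
  have "2 * slope \<le> c * len" if "0 < c" "c \<le> 1" for c
  proof -
    have "c * (2 * slope) \<le> c * (c * len)"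
      using closest[OF that] unfolding expand by (simp add: power2_eq_square mult_ac)
    with \<open>0 < c\<close> show ?thesis by simp
  qed
  then have "\<forall>\<^sub>F c in at_right 0. 2 * slope \<le> c * len"
    by (intro eventually_at_rightI[of 0 1]) auto
  moreover have "((\<lambda>c. c * len) \<longlongrightarrow> 0 * len) (at_right 0)"
    by (intro tendsto_intros)
  ultimately have "2 * slope \<le> 0 * len"
    by (intro tendsto_lowerbound[of "\<lambda>c. c * len" "0 * len" "at_right 0" "2 * slope"]) simp_all
  then show ?thesis by (simp add: slope_def)
qed

definition kernel_dist_squared :: "'a set \<Rightarrow> 'a kernel \<Rightarrow> 'a kernel \<Rightarrow> real" where
  "kernel_dist_squared I X Y = (\<Sum>p\<in>I. \<Sum>q\<in>I. (cmod (X p q - Y p q))\<^sup>2)"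

lemma kernel_dist_squared_cong:
  assumes "\<And>p q. p \<in> I \<Longrightarrow> q \<in> I \<Longrightarrow> Y p q = Y' p q"
  shows "kernel_dist_squared I X Y = kernel_dist_squared I X Y'"
  unfolding kernel_dist_squared_def using assms by (intro sum.cong refl) simp

lemma channel_kernel_bounded_representative:
  assumes fin: "finite S" "finite T" and C: "channel_kernel S T C"
  shows "\<exists>D. channel_kernel S T D \<and> (\<forall>p q. cmod (D p q) \<le> 1) \<and>
    (\<forall>p\<in>S \<times> T. \<forall>q\<in>S \<times> T. D p q = C p q)"
proof (intro exI conjI allI ballI)
  let ?D = "\<lambda>p q. if p \<in> S \<times> T \<and> q \<in> S \<times> T then C p q else 0"
  show "channel_kernel S T ?D"
    using C by (subst channel_kernel_cong[of S T _ C]) auto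
  show "cmod (?D p q) \<le> 1" for p q
    using channel_kernel_norm_le[OF fin C] by simp
qed simp

lemma closest_channel_image_exists:
  assumes fin: "finite S" "finite T" and "T \<noteq> {}"
  obtains C where "channel_kernel S T C"
    "\<And>C'. channel_kernel S T C' \<Longrightarrow> kernel_dist_squared (N \<times> T) Z (link_product S A C)
      \<le> kernel_dist_squared (N \<times> T) Z (link_product S A C')"
proof -
  define bounded where "bounded = {C. channel_kernel S T C \<and> (\<forall>p q. cmod (C p q) \<le> 1)}"
  let ?dist = "\<lambda>C. kernel_dist_squared (N \<times> T) Z (link_product S A C)"
  have "bounded \<noteq> {}"
    using channel_kernel_bounded_representative[OF fin
        channel_kernel_depolarizing[OF fin \<open>T \<noteq> {}\<close>]] by (auto simp: bounded_def)
  moreover have "compact bounded" unfolding bounded_def by (rule compact_channel_kernels)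
  moreover have "continuous_on bounded ?dist"
    unfolding kernel_dist_squared_def link_product_def split_beta
    by (intro continuous_intros continuous_on_kernel_entry)
  ultimately obtain C where C: "C \<in> bounded"
    and closest: "\<And>D. D \<in> bounded \<Longrightarrow> ?dist C \<le> ?dist D"
    using continuous_attains_inf by metis
  show thesis
  proof
    show "channel_kernel S T C" using C by (simp add: bounded_def)
    fix C' assume "channel_kernel S T C'"
    then obtain D where D: "D \<in> bounded" "\<And>p q. p \<in> S \<times> T \<Longrightarrow> q \<in> S \<times> T \<Longrightarrow> D p q = C' p q"
      using channel_kernel_bounded_representative[OF fin] unfolding bounded_def by blast
    have "?dist D = ?dist C'"
      by (intro kernel_dist_squared_cong link_product_cong[of _ N T]) (simp_all add: D(2))
    then show "?dist C \<le> ?dist C'" using closest[OF D(1)] by simp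
  qed
qed

lemma closest_channel_image_inner_le:
  assumes C: "channel_kernel S T C" and C': "channel_kernel S T C'"
    and closest: "\<And>D. channel_kernel S T D \<Longrightarrow>
      kernel_dist_squared I Z (link_product S A C) \<le> kernel_dist_squared I Z (link_product S A D)"
  shows "(\<Sum>p\<in>I. \<Sum>q\<in>I. inner (Z p q - link_product S A C p q)
    (link_product S A C' p q - link_product S A C p q)) \<le> 0"
  unfolding sum.cartesian_product split_beta
proof (rule sum_inner_closest_point_le)
  fix c :: real assume "0 < c" "c \<le> 1"
  then have "channel_kernel S T (\<lambda>p q. of_real (1 - c) * C p q + of_real c * C' p q)"
    using channel_kernel_convex[OF C C'] by simp
  from closest[OF this]
  show "(\<Sum>i\<in>I \<times> I. (cmod (Z (fst i) (snd i) - link_product S A C (fst i) (snd i)))\<^sup>2)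
    \<le> (\<Sum>i\<in>I \<times> I. (cmod (Z (fst i) (snd i) - ((1 - c) *\<^sub>R link_product S A C (fst i) (snd i)
        + c *\<^sub>R link_product S A C' (fst i) (snd i))))\<^sup>2)"
    unfolding kernel_dist_squared_def link_product_convex_right sum.cartesian_product split_beta .
qed

lemma separating_hermitian_kernel_exists:
  assumes fin: "finite N" "finite S" "finite T" and "T \<noteq> {}"
    and psd: "psd_on (N \<times> S) \<Phi>" "psd_on (N \<times> T) \<Psi>" and not_degraded: "\<not> degrades_to N S T \<Phi> \<Psi>"
  obtains G c where "hermitian_on (N \<times> T) G"
    "\<And>C. channel_kernel S T C \<Longrightarrow> Re (kernel_trace (N \<times> T) G (link_product S \<Phi> C)) \<le> c"
    "c < Re (kernel_trace (N \<times> T) G \<Psi>)"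
proof -
  let ?I = "N \<times> T" and ?image = "link_product S \<Phi>"
  obtain C where C: "channel_kernel S T C" and closest: "\<And>C'. channel_kernel S T C' \<Longrightarrow>
      kernel_dist_squared ?I \<Psi> (?image C) \<le> kernel_dist_squared ?I \<Psi> (?image C')"
    using closest_channel_image_exists[OF fin(2,3) \<open>T \<noteq> {}\<close>] by blast
  define G where "G p q = \<Psi> p q - ?image C p q" for p q
  have "psd_on ?I (?image C)"
    using C psd(1) fin by (intro psd_on_link_product) (simp_all add: channel_kernel_def)
  then have herm: "hermitian_on ?I G"
    using psd_on_hermitian_on[of ?I "?image C"] psd_on_hermitian_on[OF psd(2)] fin
    unfolding hermitian_on_def G_def complex_cnj_diff by (metis finite_cartesian_product)
  have trace: "(\<Sum>p\<in>?I. \<Sum>q\<in>?I. inner (G p q) (X p q - ?image C p q))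
      = Re (kernel_trace ?I G X) - Re (kernel_trace ?I G (?image C))" for X
    by (simp add: Re_kernel_trace_hermitian[OF herm] inner_diff_right sum_subtractf)
  show thesis
  proof
    show "hermitian_on ?I G" by (rule herm)
    show "Re (kernel_trace ?I G (?image C')) \<le> Re (kernel_trace ?I G (?image C))"
      if "channel_kernel S T C'" for C'
      using closest_channel_image_inner_le[OF C that closest] trace[of "?image C'"]
      by (simp add: G_def)
    obtain p q where pq: "p \<in> ?I" "q \<in> ?I" "G p q \<noteq> 0"
      using not_degraded C unfolding degrades_to_def G_def by auto
    have "0 < (\<Sum>(p, q)\<in>?I \<times> ?I. inner (G p q) (G p q))"
      using pq fin by (intro sum_pos2[of _ "(p, q)"]) auto
    also have "\<dots> = (\<Sum>p\<in>?I. \<Sum>q\<in>?I. inner (G p q) (\<Psi> p q - ?image C p q))"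
      by (simp add: G_def sum.cartesian_product)
    finally show "Re (kernel_trace ?I G (?image C)) < Re (kernel_trace ?I G \<Psi>)"
      by (simp add: trace)
  qed
qed

section \<open>Operators on tensor products and their Choi kernels\<close>

definition tensor_index :: "nat \<Rightarrow> nat \<times> nat \<Rightarrow> nat" where
  "tensor_index d = (\<lambda>(x, y). x * d + y)"

definition tensor_entry :: "nat \<Rightarrow> complex mat \<Rightarrow> (nat \<times> nat) kernel" where
  "tensor_entry d A p q = A $$ (tensor_index d p, tensor_index d q)"

definition tensor_mat :: "nat \<Rightarrow> nat \<Rightarrow> (nat \<times> nat) kernel \<Rightarrow> complex mat" where
  "tensor_mat m d X = mat (m * d) (m * d) (\<lambda>(p, q). X (p div d, p mod d) (q div d, q mod d))"

lemma bij_betw_tensor_index: "bij_betw (tensor_index d) ({..<m} \<times> {..<d}) {..<m * d}"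
proof (rule bij_betw_byWitness[where f' = "\<lambda>p. (p div d, p mod d)"])
  show "tensor_index d ` ({..<m} \<times> {..<d}) \<subseteq> {..<m * d}"
  proof clarsimp
    fix x y assume "x < m" "y < d"
    then have "x * d + y < (x + 1) * d" "(x + 1) * d \<le> m * d"
      by (simp, intro mult_le_mono1) simp
    then show "tensor_index d (x, y) < m * d" by (simp add: tensor_index_def)
  qed
qed (auto simp: tensor_index_def less_mult_imp_div_less intro!: mod_less_divisor gr0I)

lemma tensor_index_less: "p \<in> {..<m} \<times> {..<d} \<Longrightarrow> tensor_index d p < m * d"
  using bij_betwE[OF bij_betw_tensor_index] by blast

lemma tensor_index_eq_iff:
  "p \<in> {..<m} \<times> {..<d} \<Longrightarrow> q \<in> {..<m} \<times> {..<d} \<Longrightarrow> tensor_index d p = tensor_index d q \<longleftrightarrow> p = q"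
  using inj_on_eq_iff[OF bij_betw_imp_inj_on[OF bij_betw_tensor_index]] .

lemma all_less_mult_iff:
  "(\<forall>i<m * d. Q i) \<longleftrightarrow> (\<forall>p\<in>{..<m} \<times> {..<d}. Q (tensor_index d p))"
proof -
  have "(\<forall>i<m * d. Q i) \<longleftrightarrow> (\<forall>i\<in>tensor_index d ` ({..<m} \<times> {..<d}). Q i)"
    unfolding bij_betw_imp_surj_on[OF bij_betw_tensor_index] by blast
  then show ?thesis by blast
qed

lemma sum_tensor_index: "(\<Sum>i<m * d. f i) = (\<Sum>p\<in>{..<m} \<times> {..<d}. f (tensor_index d p))"
  by (rule sum.reindex_bij_betw[OF bij_betw_tensor_index, symmetric])

lemma tensor_mat_carrier [simp]: "tensor_mat m d X \<in> carrier_mat (m * d) (m * d)"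
  by (simp add: tensor_mat_def)

lemma tensor_entry_tensor_mat:
  assumes "p \<in> {..<m} \<times> {..<d}" "q \<in> {..<m} \<times> {..<d}"
  shows "tensor_entry d (tensor_mat m d X) p q = X p q"
  using assms tensor_index_less[OF assms(1)] tensor_index_less[OF assms(2)]
  by (auto simp: tensor_entry_def tensor_mat_def tensor_index_def)

lemma mat_eq_tensor_iff:
  assumes "A \<in> carrier_mat (m * d) (m * d)" "B \<in> carrier_mat (m * d) (m * d)"
  shows "A = B \<longleftrightarrow> (\<forall>p\<in>{..<m} \<times> {..<d}. \<forall>q\<in>{..<m} \<times> {..<d}.
    tensor_entry d A p q = tensor_entry d B p q)"
proof -
  have "A = B \<longleftrightarrow> (\<forall>i<m * d. \<forall>j<m * d. A $$ (i, j) = B $$ (i, j))"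
    using assms by (auto simp: mat_eq_iff)
  then show ?thesis by (simp only: all_less_mult_iff tensor_entry_def)
qed

lemma psd_op_tensor_iff:
  "psd_op (m * d) A \<longleftrightarrow>
    A \<in> carrier_mat (m * d) (m * d) \<and> psd_on ({..<m} \<times> {..<d}) (tensor_entry d A)"
proof -
  have "psd_op (m * d) A \<longleftrightarrow>
      A \<in> carrier_mat (m * d) (m * d) \<and> psd_on {..<m * d} (\<lambda>i j. A $$ (i, j))"
    by (auto simp: psd_op_def psd_on_def quad_form_def less_eq_complex_def)
  then show ?thesis
    using psd_on_bij_betw_iff[OF bij_betw_tensor_index[of d m] finite_lessThan,
        of "\<lambda>i j. A $$ (i, j)"]
    by (simp add: tensor_entry_def[abs_def])
qed

lemma psd_op_tensor_mat_iff: "psd_op (m * d) (tensor_mat m d X) \<longleftrightarrow> psd_on ({..<m} \<times> {..<d}) X"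
  using psd_on_cong[OF tensor_entry_tensor_mat] by (simp add: psd_op_tensor_iff)

lemma mtrace_tensor:
  assumes "A \<in> carrier_mat (m * d) (m * d)"
  shows "mtrace A = (\<Sum>p\<in>{..<m} \<times> {..<d}. tensor_entry d A p p)"
  using assms by (simp add: mtrace_def tensor_entry_def sum_tensor_index)

lemma density_op_tensor_iff:
  "density_op (m * d) \<rho> \<longleftrightarrow> \<rho> \<in> carrier_mat (m * d) (m * d) \<and>
    psd_on ({..<m} \<times> {..<d}) (tensor_entry d \<rho>) \<and> (\<Sum>p\<in>{..<m} \<times> {..<d}. tensor_entry d \<rho> p p) = 1"
  by (auto simp: density_op_def psd_op_tensor_iff mtrace_tensor)

lemma density_op_tensor_mat_iff:
  "density_op (m * d) (tensor_mat m d X) \<longleftrightarrow>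
    psd_on ({..<m} \<times> {..<d}) X \<and> (\<Sum>p\<in>{..<m} \<times> {..<d}. X p p) = 1"
  by (simp add: density_op_def psd_op_tensor_mat_iff mtrace_tensor[OF tensor_mat_carrier]
      tensor_entry_tensor_mat)

lemma hermitian_op_tensor_mat:
  assumes "hermitian_on ({..<m} \<times> {..<d}) X"
  shows "hermitian_op (m * d) (tensor_mat m d X)"
proof -
  have "tensor_mat m d X $$ (tensor_index d p, tensor_index d q)
      = cnj (tensor_mat m d X $$ (tensor_index d q, tensor_index d p))"
    if "p \<in> {..<m} \<times> {..<d}" "q \<in> {..<m} \<times> {..<d}" for p q
    using hermitian_onD[OF assms that(2,1)] tensor_entry_tensor_mat[OF that, of X]
      tensor_entry_tensor_mat[OF that(2,1), of X] by (simp add: tensor_entry_def)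
  then show ?thesis
    unfolding hermitian_op_def all_less_mult_iff by (simp only: tensor_mat_carrier) blast
qed

text \<open>The transpose makes the contraction of a state with a measurement operator a link product.\<close>

definition effect_kernel :: "nat \<Rightarrow> complex mat \<Rightarrow> (nat \<times> nat) kernel" where
  "effect_kernel d D p q = tensor_entry d D q p"

lemma is_povm_tensor_iff:
  "is_povm (m * d) k D \<longleftrightarrow> (\<forall>i<k. D i \<in> carrier_mat (m * d) (m * d)) \<and>
    povm_on ({..<m} \<times> {..<d}) k (\<lambda>i. effect_kernel d (D i))"
proof -
  have "(\<Sum>i<k. D i $$ (tensor_index d p, tensor_index d q))
        = (if tensor_index d p = tensor_index d q then 1 else 0) \<longleftrightarrow>
      (\<Sum>i<k. effect_kernel d (D i) q p) = of_bool (q = p)"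
    if "p \<in> {..<m} \<times> {..<d}" "q \<in> {..<m} \<times> {..<d}" for p q
    using tensor_index_eq_iff[OF that] by (auto simp: effect_kernel_def tensor_entry_def)
  then have "(\<forall>a<m * d. \<forall>b<m * d. (\<Sum>i<k. D i $$ (a, b)) = (if a = b then 1 else 0)) \<longleftrightarrow>
      (\<forall>p\<in>{..<m} \<times> {..<d}. \<forall>q\<in>{..<m} \<times> {..<d}. (\<Sum>i<k. effect_kernel d (D i) p q) = of_bool (p = q))"
    unfolding all_less_mult_iff by blast
  moreover have "psd_on I (effect_kernel d (D i)) \<longleftrightarrow> psd_on I (tensor_entry d (D i))" for I i
    using psd_on_transpose_iff[of I "tensor_entry d (D i)"]
    by (simp add: effect_kernel_def[abs_def])
  ultimately show ?thesis
    unfolding is_povm_def povm_on_def psd_op_tensor_iff by blast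
qed

definition mat_unit :: "nat \<Rightarrow> nat \<Rightarrow> nat \<Rightarrow> complex mat" where
  "mat_unit d i j = mat d d (\<lambda>(a, b). of_bool (a = i) * of_bool (b = j))"

lemma mat_unit_carrier [simp]: "mat_unit d i j \<in> carrier_mat d d"
  by (simp add: mat_unit_def)

lemma linear_op_map_carrier:
  "linear_op_map dS dT E \<Longrightarrow> A \<in> carrier_mat dS dS \<Longrightarrow> E A \<in> carrier_mat dT dT"
  by (simp add: linear_op_map_def)

lemma linear_op_map_smult:
  "linear_op_map dS dT E \<Longrightarrow> A \<in> carrier_mat dS dS \<Longrightarrow> E (c \<cdot>\<^sub>m A) = c \<cdot>\<^sub>m E A"
  by (simp add: linear_op_map_def)

lemma linear_op_map_zero:
  assumes E: "linear_op_map dS dT E"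
  shows "E (0\<^sub>m dS dS) = 0\<^sub>m dT dT"
proof -
  have "E (0\<^sub>m dS dS) \<in> carrier_mat dT dT"
    using E by (rule linear_op_map_carrier) simp
  then have "0 \<cdot>\<^sub>m E (0\<^sub>m dS dS) = 0\<^sub>m dT dT" by (intro eq_matI) auto
  moreover have "E (0 \<cdot>\<^sub>m 0\<^sub>m dS dS) = 0 \<cdot>\<^sub>m E (0\<^sub>m dS dS)"
    by (rule linear_op_map_smult[OF E zero_carrier_mat])
  ultimately show ?thesis by simp
qed

lemma linear_op_map_sum_units:
  assumes E: "linear_op_map dS dT E" and "finite F" and t: "t < dT" "t' < dT"
  shows "E (mat dS dS (\<lambda>p. of_bool (p \<in> F) * f p)) $$ (t, t')
    = (\<Sum>(s, s')\<in>F. f (s, s') * E (mat_unit dS s s') $$ (t, t'))"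
  using \<open>finite F\<close>
proof (induction F)
  case empty
  have "mat dS dS (\<lambda>p. of_bool (p \<in> {}) * f p) = 0\<^sub>m dS dS" by (intro eq_matI) auto
  then show ?case using linear_op_map_zero[OF E] t by simp
next
  case (insert p F)
  obtain s s' where p: "p = (s, s')" by fastforce
  let ?R = "\<lambda>F. mat dS dS (\<lambda>p. of_bool (p \<in> F) * f p)"
  have "?R (insert p F) = f p \<cdot>\<^sub>m mat_unit dS s s' + ?R F"
    using insert.hyps p by (intro eq_matI) (auto simp: mat_unit_def)
  then have "E (?R (insert p F)) = f p \<cdot>\<^sub>m E (mat_unit dS s s') + E (?R F)"
    using E unfolding linear_op_map_def by simp
  moreover have "E (mat_unit dS s s') \<in> carrier_mat dT dT" "E (?R F) \<in> carrier_mat dT dT"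
    by (simp_all add: linear_op_map_carrier[OF E])
  ultimately show ?case
    using insert t p by simp
qed

definition choi_kernel :: "nat \<Rightarrow> (complex mat \<Rightarrow> complex mat) \<Rightarrow> (nat \<times> nat) kernel" where
  "choi_kernel d E = (\<lambda>(s, t) (s', t'). E (mat_unit d s s') $$ (t, t'))"

lemma linear_op_map_choi_kernel:
  assumes E: "linear_op_map dS dT E" and X: "X \<in> carrier_mat dS dS" and t: "t < dT" "t' < dT"
  shows "E X $$ (t, t') = (\<Sum>s<dS. \<Sum>s'<dS. X $$ (s, s') * choi_kernel dS E (s, t) (s', t'))"
proof -
  let ?I = "{..<dS} \<times> {..<dS}"
  have "X = mat dS dS (\<lambda>p. of_bool (p \<in> ?I) * X $$ p)"
    using X by (intro eq_matI) auto
  then have "E X $$ (t, t') = E (mat dS dS (\<lambda>p. of_bool (p \<in> ?I) * X $$ p)) $$ (t, t')"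
    by simp
  also have "\<dots> = (\<Sum>(s, s')\<in>?I. X $$ (s, s') * E (mat_unit dS s s') $$ (t, t'))"
    by (rule linear_op_map_sum_units[OF E _ t]) simp
  also have "\<dots> = (\<Sum>s<dS. \<Sum>s'<dS. X $$ (s, s') * choi_kernel dS E (s, t) (s', t'))"
    by (simp add: choi_kernel_def sum.cartesian_product)
  finally show ?thesis .
qed

lemma id_tensor_carrier [simp]: "id_tensor m dS dT E X \<in> carrier_mat (m * dT) (m * dT)"
  by (simp add: id_tensor_def)

lemma tensor_entry_id_tensor:
  assumes E: "linear_op_map dS dT E" and pq: "p \<in> {..<m} \<times> {..<dT}" "q \<in> {..<m} \<times> {..<dT}"
  shows "tensor_entry dT (id_tensor m dS dT E X) p q
    = link_product {..<dS} (tensor_entry dS X) (choi_kernel dS E) p q"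
  using assms tensor_index_less[OF pq(1)] tensor_index_less[OF pq(2)]
  by (auto simp: tensor_entry_def id_tensor_def tensor_index_def linear_op_map_choi_kernel[OF E])

lemma completely_positive_iff_psd_choi_kernel:
  assumes E: "linear_op_map dS dT E"
  shows "completely_positive dS dT E \<longleftrightarrow> psd_on ({..<dS} \<times> {..<dT}) (choi_kernel dS E)"
proof
  let ?\<Omega> = "tensor_mat dS dS identity_kernel"
  assume "completely_positive dS dT E"
  moreover have "psd_op (dS * dS) ?\<Omega>"
    by (simp add: psd_op_tensor_mat_iff psd_on_rank_one flip: rank_one_kernel_eq_identity_kernel)
  ultimately have "psd_on ({..<dS} \<times> {..<dT}) (tensor_entry dT (id_tensor dS dS dT E ?\<Omega>))"
    unfolding completely_positive_def psd_op_tensor_iff by blast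
  also have "?this \<longleftrightarrow> psd_on ({..<dS} \<times> {..<dT}) (choi_kernel dS E)"
  proof (rule psd_on_cong)
    fix p q assume pq: "p \<in> {..<dS} \<times> {..<dT}" "q \<in> {..<dS} \<times> {..<dT}"
    have "tensor_entry dT (id_tensor dS dS dT E ?\<Omega>) p q
        = link_product {..<dS} (tensor_entry dS ?\<Omega>) (choi_kernel dS E) p q"
      using tensor_entry_id_tensor[OF E pq] .
    also have "\<dots> = link_product {..<dS} identity_kernel (choi_kernel dS E) p q"
      using pq by (rule link_product_cong) (rule tensor_entry_tensor_mat, assumption+, rule refl)
    also have "\<dots> = choi_kernel dS E p q"
      using pq by (simp add: link_product_identity_left)
    finally show "tensor_entry dT (id_tensor dS dS dT E ?\<Omega>) p q = choi_kernel dS E p q" .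
  qed
  finally show "psd_on ({..<dS} \<times> {..<dT}) (choi_kernel dS E)" .
next
  assume choi: "psd_on ({..<dS} \<times> {..<dT}) (choi_kernel dS E)"
  show "completely_positive dS dT E"
    unfolding completely_positive_def psd_op_tensor_iff
    by (auto simp: psd_on_cong[OF tensor_entry_id_tensor[OF E]] intro!: psd_on_link_product choi)
qed

lemma trace_preserving_iff_choi_kernel:
  assumes E: "linear_op_map dS dT E"
  shows "trace_preserving dS dT E \<longleftrightarrow>
    (\<forall>s<dS. \<forall>s'<dS. (\<Sum>t<dT. choi_kernel dS E (s, t) (s', t)) = of_bool (s = s'))"
proof
  assume tp: "trace_preserving dS dT E"
  show "\<forall>s<dS. \<forall>s'<dS. (\<Sum>t<dT. choi_kernel dS E (s, t) (s', t)) = of_bool (s = s')"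
  proof (intro allI impI)
    fix s s' assume "s < dS" "s' < dS"
    have "(\<Sum>t<dT. choi_kernel dS E (s, t) (s', t)) = mtrace (E (mat_unit dS s s'))"
      by (simp add: mtrace_def choi_kernel_def carrier_matD(1)[OF linear_op_map_carrier[OF E]])
    also have "\<dots> = mtrace (mat_unit dS s s')"
      using tp by (simp add: trace_preserving_def)
    also have "\<dots> = (\<Sum>i<dS. of_bool (s = s') * of_bool (i = s))"
      unfolding mtrace_def by (rule sum.cong) (auto simp: mat_unit_def)
    also have "\<dots> = of_bool (s = s')"
      using \<open>s < dS\<close> by simp
    finally show "(\<Sum>t<dT. choi_kernel dS E (s, t) (s', t)) = of_bool (s = s')" .
  qed
next
  assume choi: "\<forall>s<dS. \<forall>s'<dS. (\<Sum>t<dT. choi_kernel dS E (s, t) (s', t)) = of_bool (s = s')"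
  show "trace_preserving dS dT E"
    unfolding trace_preserving_def
  proof
    fix X :: "complex mat" assume X: "X \<in> carrier_mat dS dS"
    have "mtrace (E X) = (\<Sum>t<dT. \<Sum>s<dS. \<Sum>s'<dS. X $$ (s, s') * choi_kernel dS E (s, t) (s', t))"
      by (simp add: mtrace_def linear_op_map_choi_kernel[OF E X]
          carrier_matD(1)[OF linear_op_map_carrier[OF E X]])
    also have "\<dots> = (\<Sum>s<dS. \<Sum>s'<dS. X $$ (s, s') * (\<Sum>t<dT. choi_kernel dS E (s, t) (s', t)))"
      unfolding sum_distrib_left by (subst sum.swap, subst (2) sum.swap) (rule refl)
    also have "\<dots> = mtrace X"
      using X choi by (simp add: mtrace_def)
    finally show "mtrace (E X) = mtrace X" .
  qed
qed

lemma cptp_iff_channel_kernel: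
  assumes "linear_op_map dS dT E"
  shows "cptp dS dT E \<longleftrightarrow> channel_kernel {..<dS} {..<dT} (choi_kernel dS E)"
  using assms unfolding cptp_def channel_kernel_def
  by (auto simp: completely_positive_iff_psd_choi_kernel trace_preserving_iff_choi_kernel)

definition map_of_kernel :: "nat \<Rightarrow> nat \<Rightarrow> (nat \<times> nat) kernel \<Rightarrow> complex mat \<Rightarrow> complex mat" where
  "map_of_kernel dS dT C X =
    mat dT dT (\<lambda>(t, t'). \<Sum>s<dS. \<Sum>s'<dS. X $$ (s, s') * C (s, t) (s', t'))"

lemma linear_op_map_map_of_kernel: "linear_op_map dS dT (map_of_kernel dS dT C)"
  unfolding linear_op_map_def
  by (auto simp: map_of_kernel_def sum.distrib distrib_right sum_distrib_left mult.assoc)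

lemma choi_kernel_map_of_kernel:
  assumes "p \<in> {..<dS} \<times> {..<dT}" "q \<in> {..<dS} \<times> {..<dT}"
  shows "choi_kernel dS (map_of_kernel dS dT C) p q = C p q"
  using assms
  by (auto simp: choi_kernel_def map_of_kernel_def mat_unit_def sum_sum_mult_of_bool_eq)

lemma ex_cptp_iff_degrades_to:
  assumes \<Psi>: "\<Psi> \<in> carrier_mat (dN * dT) (dN * dT)"
  shows "(\<exists>E. cptp dS dT E \<and> \<Psi> = id_tensor dN dS dT E \<Phi>) \<longleftrightarrow>
    degrades_to {..<dN} {..<dS} {..<dT} (tensor_entry dS \<Phi>) (tensor_entry dT \<Psi>)"
proof -
  let ?link = "link_product {..<dS} (tensor_entry dS \<Phi>)"
  have image: "\<Psi> = id_tensor dN dS dT E \<Phi> \<longleftrightarrow> (\<forall>p\<in>{..<dN} \<times> {..<dT}. \<forall>q\<in>{..<dN} \<times> {..<dT}.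
      tensor_entry dT \<Psi> p q = ?link (choi_kernel dS E) p q)" if "linear_op_map dS dT E" for E
    unfolding mat_eq_tensor_iff[OF \<Psi> id_tensor_carrier]
    by (simp add: tensor_entry_id_tensor[OF that])
  show ?thesis
  proof
    assume "\<exists>E. cptp dS dT E \<and> \<Psi> = id_tensor dN dS dT E \<Phi>"
    then show "degrades_to {..<dN} {..<dS} {..<dT} (tensor_entry dS \<Phi>) (tensor_entry dT \<Psi>)"
      using image cptp_iff_channel_kernel unfolding degrades_to_def cptp_def by metis
  next
    assume "degrades_to {..<dN} {..<dS} {..<dT} (tensor_entry dS \<Phi>) (tensor_entry dT \<Psi>)"
    then obtain C where C: "channel_kernel {..<dS} {..<dT} C"
      and C_image: "\<And>p q. p \<in> {..<dN} \<times> {..<dT} \<Longrightarrow> q \<in> {..<dN} \<times> {..<dT} \<Longrightarrow>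
        tensor_entry dT \<Psi> p q = ?link C p q"
      unfolding degrades_to_def by blast
    let ?E = "map_of_kernel dS dT C"
    have "cptp dS dT ?E"
      unfolding cptp_iff_channel_kernel[OF linear_op_map_map_of_kernel]
      using C by (subst channel_kernel_cong[OF choi_kernel_map_of_kernel])
    moreover have "\<Psi> = id_tensor dN dS dT ?E \<Phi>"
      unfolding image[OF linear_op_map_map_of_kernel]
    proof (intro ballI)
      fix p q assume pq: "p \<in> {..<dN} \<times> {..<dT}" "q \<in> {..<dN} \<times> {..<dT}"
      have "?link C p q = ?link (choi_kernel dS ?E) p q"
        using pq by (rule link_product_cong) (rule refl, rule choi_kernel_map_of_kernel[symmetric])
      with C_image[OF pq] show "tensor_entry dT \<Psi> p q = ?link (choi_kernel dS ?E) p q" by simp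
    qed
    ultimately show "\<exists>E. cptp dS dT E \<and> \<Psi> = id_tensor dN dS dT E \<Phi>" by blast
  qed
qed

section \<open>Teleportation\<close>

locale unitary_error_basis =
  fixes d :: nat and w :: "nat \<Rightarrow> nat \<times> nat \<Rightarrow> complex"
  assumes dim_pos: "0 < d"
    and rows_orthonormal: "i < d * d \<Longrightarrow> a < d \<Longrightarrow> b < d \<Longrightarrow>
      (\<Sum>c<d. w i (a, c) * cnj (w i (b, c))) = of_bool (a = b)"
    and columns_orthonormal: "i < d * d \<Longrightarrow> a < d \<Longrightarrow> b < d \<Longrightarrow>
      (\<Sum>c<d. w i (c, a) * cnj (w i (c, b))) = of_bool (a = b)"
    and complete: "p \<in> {..<d} \<times> {..<d} \<Longrightarrow> q \<in> {..<d} \<times> {..<d} \<Longrightarrow>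
      (\<Sum>i<d * d. w i p * cnj (w i q)) = of_nat d * of_bool (p = q)"
begin

definition bell_kernel :: "nat \<Rightarrow> (nat \<times> nat) kernel" where
  "bell_kernel i = (\<lambda>p q. of_real (1 / real d) * rank_one_kernel (w i) p q)"

definition correction_kernel :: "nat \<Rightarrow> (nat \<times> nat) kernel" where
  "correction_kernel i = rank_one_kernel (\<lambda>(b, a). cnj (w i (a, b)))"

definition entangled_kernel :: "(nat \<times> nat) kernel" where
  "entangled_kernel = (\<lambda>p q. of_real (1 / real d) * identity_kernel p q)"

lemma povm_on_bell_kernel: "povm_on ({..<d} \<times> {..<d}) (d * d) bell_kernel"
proof -
  have "psd_on ({..<d} \<times> {..<d}) (bell_kernel i)" for i
    unfolding bell_kernel_def
    by (intro psd_on_scale psd_on_rank_one) (simp add: less_eq_complex_def)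
  moreover have "(\<Sum>i<d * d. bell_kernel i p q) = of_bool (p = q)"
    if "p \<in> {..<d} \<times> {..<d}" "q \<in> {..<d} \<times> {..<d}" for p q
    using complete[OF that] dim_pos
    by (simp add: bell_kernel_def rank_one_kernel_def flip: sum_divide_distrib)
  ultimately show ?thesis by (simp add: povm_on_def)
qed

lemma channel_kernel_correction_kernel:
  assumes "i < d * d"
  shows "channel_kernel {..<d} {..<d} (correction_kernel i)"
  using columns_orthonormal[OF assms]
  by (auto simp: channel_kernel_def correction_kernel_def psd_on_rank_one rank_one_kernel_def
      mult.commute)

lemma psd_on_entangled_kernel: "psd_on ({..<d} \<times> {..<d}) entangled_kernel"
  unfolding entangled_kernel_def rank_one_kernel_eq_identity_kernel[symmetric]
  by (intro psd_on_scale psd_on_rank_one) (simp add: less_eq_complex_def)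

lemma trace_entangled_kernel: "(\<Sum>p\<in>{..<d} \<times> {..<d}. entangled_kernel p p) = 1"
  using dim_pos
  by (simp add: entangled_kernel_def identity_kernel_def sum.cartesian_product'
      flip: of_bool_conj sum_divide_distrib)

lemma link_product_entangled_kernel:
  assumes "p \<in> A \<times> {..<d}" "q \<in> A \<times> {..<d}"
  shows "link_product {..<d} X entangled_kernel p q = of_real (1 / real d) * X p q"
  unfolding entangled_kernel_def link_product_scale_right
  using link_product_identity_right[OF finite_lessThan assms] by simp

lemma teleportation:
  assumes pq: "p \<in> {..<d} \<times> {..<d}" "q \<in> {..<d} \<times> {..<d}"
  shows "measure_and_correct {..<d} {..<d} (d * d) bell_kernel entangled_kernel correction_kernel
    p q = identity_kernel p q"
proof -
  let ?c = "of_real (1 / real d) :: complex" and ?link = "link_product {..<d}"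
  have "?link (?link (bell_kernel i) entangled_kernel) (correction_kernel i) p q
      = ?c * (?c * identity_kernel p q)" if i: "i < d * d" for i
  proof -
    have "?link (?link (bell_kernel i) entangled_kernel) (correction_kernel i) p q
        = ?link (\<lambda>p q. ?c * bell_kernel i p q) (correction_kernel i) p q"
      by (rule link_product_cong[OF pq link_product_entangled_kernel refl])
    also have "\<dots> = ?c * (?c * ?link (rank_one_kernel (w i)) (correction_kernel i) p q)"
      by (simp only: bell_kernel_def link_product_scale_left)
    also have "?link (rank_one_kernel (w i)) (correction_kernel i) p q = identity_kernel p q"
      unfolding correction_kernel_def link_product_rank_one
        rank_one_kernel_eq_identity_kernel[symmetric]
      using pq rows_orthonormal[OF i] by (auto simp: rank_one_kernel_def simp del: cnj_sum)
    finally show ?thesis .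
  qed
  then show ?thesis using dim_pos by (simp add: measure_and_correct_def)
qed

end

definition root_of_unity :: "nat \<Rightarrow> nat \<Rightarrow> complex" where
  "root_of_unity d t = cis (2 * pi * real t / real d)"

lemma root_of_unity_mult_cnj: "root_of_unity d t * cnj (root_of_unity d t) = 1"
  by (simp add: root_of_unity_def cis_cnj cis_mult)

lemma root_of_unity_power:
  assumes "0 < d"
  shows "root_of_unity d t ^ d = 1"
  unfolding root_of_unity_def DeMoivre using assms by simp

lemma root_of_unity_eq_iff:
  assumes "s < d" "t < d"
  shows "root_of_unity d s = root_of_unity d t \<longleftrightarrow> s = t"
proof -
  have "inj_on (root_of_unity d) {..<d}"
    using bij_betw_imp_inj_on[OF bij_betw_roots_unity, of d] assms
    by (simp add: root_of_unity_def[abs_def])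
  then show ?thesis using assms by (auto dest: inj_onD)
qed

lemma sum_root_of_unity_powers:
  assumes "s < d" "t < d"
  shows "(\<Sum>j<d. root_of_unity d s ^ j * cnj (root_of_unity d t ^ j)) = of_nat d * of_bool (s = t)"
proof -
  define z where "z = root_of_unity d s * cnj (root_of_unity d t)"
  have sum: "(\<Sum>j<d. root_of_unity d s ^ j * cnj (root_of_unity d t ^ j)) = (\<Sum>j<d. z ^ j)"
    by (simp add: z_def power_mult_distrib)
  show ?thesis
  proof (cases "s = t")
    case True
    then have "z = 1" by (simp add: z_def root_of_unity_mult_cnj)
    then show ?thesis using sum True by simp
  next
    case False
    have "root_of_unity d s = z * root_of_unity d t"
      by (simp add: z_def mult.assoc root_of_unity_mult_cnj mult.commute[of "cnj _"])
    then have "z \<noteq> 1" using False assms root_of_unity_eq_iff by auto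
    moreover have "z ^ d = 1"
      using assms
      by (simp add: z_def power_mult_distrib root_of_unity_power flip: complex_cnj_power)
    ultimately show ?thesis using sum False by (simp add: geometric_sum)
  qed
qed

definition weyl :: "nat \<Rightarrow> nat \<Rightarrow> nat \<times> nat \<Rightarrow> complex" where
  "weyl d i = (\<lambda>(a, t). of_bool ((a + t) mod d = i div d) * root_of_unity d t ^ (i mod d))"

lemma add_mod_eq_iff:
  fixes a b t d :: nat
  assumes "a < d" "b < d"
  shows "(a + t) mod d = (b + t) mod d \<longleftrightarrow> a = b"
  using assms cong_add_rcancel_nat[of a t b d] by (simp add: cong_def)

lemma sum_of_bool_add_mod:
  fixes a d s :: nat
  assumes "s < d"
  shows "(\<Sum>t<d. of_bool ((a + t) mod d = s) :: complex) = 1"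
proof -
  have "inj_on (\<lambda>t. (a + t) mod d) {..<d}"
    by (rule inj_onI) (simp add: add_mod_eq_iff add.commute[of a])
  moreover have "(\<lambda>t. (a + t) mod d) ` {..<d} \<subseteq> {..<d}" using assms by auto
  ultimately have "bij_betw (\<lambda>t. (a + t) mod d) {..<d} {..<d}"
    by (simp add: bij_betw_def endo_inj_surj)
  from sum.reindex_bij_betw[OF this, of "\<lambda>x. of_bool (x = s) :: complex"]
  show ?thesis using assms by simp
qed

lemma weyl_unitary_error_basis:
  assumes "0 < d"
  shows "unitary_error_basis d (weyl d)"
proof unfold_locales
  fix i a b
  assume i: "i < d * d" and ab: "a < d" "b < d"
  then have s: "i div d < d" by (simp add: less_mult_imp_div_less)
  have unit: "root_of_unity d t ^ j * cnj (root_of_unity d t) ^ j = 1" for t j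
    by (simp add: root_of_unity_mult_cnj flip: power_mult_distrib)
  have "weyl d i (a, c) * cnj (weyl d i (b, c))
      = of_bool (a = b) * of_bool ((a + c) mod d = i div d)" for c
    using ab add_mod_eq_iff[of a d b c] unit by (auto simp: weyl_def)
  then show "(\<Sum>c<d. weyl d i (a, c) * cnj (weyl d i (b, c))) = of_bool (a = b)"
    by (simp add: sum_of_bool_add_mod[OF s] del: sum_of_bool_eq flip: sum_distrib_left)
  have "weyl d i (c, a) * cnj (weyl d i (c, b))
      = of_bool (a = b) * of_bool ((a + c) mod d = i div d)" for c
    using ab add_mod_eq_iff[of a d b c] unit by (auto simp: weyl_def add.commute[of c])
  then show "(\<Sum>c<d. weyl d i (c, a) * cnj (weyl d i (c, b))) = of_bool (a = b)"
    by (simp add: sum_of_bool_add_mod[OF s] del: sum_of_bool_eq flip: sum_distrib_left)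
next
  fix p q :: "nat \<times> nat" assume "p \<in> {..<d} \<times> {..<d}" "q \<in> {..<d} \<times> {..<d}"
  then obtain a t b s where pq: "p = (a, t)" "q = (b, s)" "a < d" "t < d" "b < d" "s < d" by auto
  have "(\<Sum>i<d * d. weyl d i p * cnj (weyl d i q))
      = (\<Sum>x<d. \<Sum>j<d. of_bool (x = (a + t) mod d) * of_bool (x = (b + s) mod d)
          * (root_of_unity d t ^ j * cnj (root_of_unity d s ^ j)))"
    unfolding sum_tensor_index sum.cartesian_product'
    by (intro sum.cong refl) (auto simp: tensor_index_def weyl_def pq)
  also have "\<dots> = (\<Sum>x<d. of_bool (x = (a + t) mod d) * of_bool (x = (b + s) mod d))
      * (of_nat d * of_bool (t = s))"
    unfolding sum_distrib_left[symmetric] sum_root_of_unity_powers[OF pq(4,6)] sum_distrib_right ..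
  also have "(\<Sum>x<d. of_bool (x = (a + t) mod d) * of_bool (x = (b + s) mod d) :: complex)
      = of_bool ((a + t) mod d = (b + s) mod d)"
    using assms by simp
  finally show "(\<Sum>i<d * d. weyl d i p * cnj (weyl d i q)) = of_nat d * of_bool (p = q)"
    using add_mod_eq_iff[OF pq(3,5), of t] by (auto simp: pq)
qed (use assms in auto)

section \<open>Games\<close>

lemma payoff_eq_kernel_trace:
  "payoff dN dS dA dB \<Phi> \<rho> k M D = Re (\<Sum>i<k. kernel_trace ({..<dN} \<times> {..<dB}) (tensor_entry dB (M i))
     (link_product {..<dA} (link_product {..<dS} (tensor_entry dS \<Phi>) (effect_kernel dA (D i)))
       (tensor_entry dB \<rho>)))"
proof -
  let ?f = "\<lambda>i n s a b n' s' a' b'.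
    \<Phi> $$ (n * dS + s, n' * dS + s') * \<rho> $$ (a * dB + b, a' * dB + b')
      * M i $$ (n' * dB + b', n * dB + b) * D i $$ (s' * dA + a', s * dA + a)"
  have "(\<Sum>n<dN. \<Sum>s<dS. \<Sum>a<dA. \<Sum>b<dB. \<Sum>n'<dN. \<Sum>s'<dS. \<Sum>a'<dA. \<Sum>b'<dB.
        ?f i n s a b n' s' a' b')
      = (\<Sum>n'<dN. \<Sum>b'<dB. \<Sum>n<dN. \<Sum>b<dB. \<Sum>a<dA. \<Sum>a'<dA. \<Sum>s<dS. \<Sum>s'<dS.
        ?f i n s a b n' s' a' b')" for i
    unfolding sum.cartesian_product
    by (rule sum.reindex_bij_witness[where
          i = "\<lambda>(n', b', n, b, a, a', s, s'). (n, s, a, b, n', s', a', b')" and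
          j = "\<lambda>(n, s, a, b, n', s', a', b'). (n', b', n, b, a, a', s, s')"]) auto
  then show ?thesis
    unfolding payoff_def kernel_trace_def sum.cartesian_product'
    by (simp only: link_product_apply effect_kernel_def tensor_entry_def tensor_index_def prod.case
        sum_distrib_left sum_distrib_right) (simp only: mult_ac)
qed

lemma payoff_eqI:
  assumes "\<And>i p q. i < k \<Longrightarrow> p \<in> {..<dN} \<times> {..<dA} \<Longrightarrow> q \<in> {..<dN} \<times> {..<dA} \<Longrightarrow>
    link_product {..<dS} (tensor_entry dS \<Phi>) (effect_kernel dA (D i)) p q
      = link_product {..<dT} (tensor_entry dT \<Psi>) (effect_kernel dA (D' i)) p q"
  shows "payoff dN dS dA dB \<Phi> \<rho> k M D = payoff dN dT dA dB \<Psi> \<rho> k M D'"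
  unfolding payoff_eq_kernel_trace
  by (intro arg_cong[where f = Re] sum.cong refl kernel_trace_cong
      link_product_cong[of _ "{..<dN}"])
    (simp_all add: assms)

definition mat_of_effect :: "nat \<Rightarrow> nat \<Rightarrow> (nat \<times> nat) kernel \<Rightarrow> complex mat" where
  "mat_of_effect m d P = tensor_mat m d (\<lambda>p q. P q p)"

lemma effect_kernel_mat_of_effect:
  assumes "p \<in> {..<m} \<times> {..<d}" "q \<in> {..<m} \<times> {..<d}"
  shows "effect_kernel d (mat_of_effect m d P) p q = P p q"
  using assms by (simp add: effect_kernel_def mat_of_effect_def tensor_entry_tensor_mat)

lemma is_povm_mat_of_effect:
  assumes "povm_on ({..<m} \<times> {..<d}) k P"
  shows "is_povm (m * d) k (\<lambda>i. mat_of_effect m d (P i))"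
  unfolding is_povm_tensor_iff
proof
  show "\<forall>i<k. mat_of_effect m d (P i) \<in> carrier_mat (m * d) (m * d)"
    by (simp add: mat_of_effect_def)
  show "povm_on ({..<m} \<times> {..<d}) k (\<lambda>i. effect_kernel d (mat_of_effect m d (P i)))"
    using assms by (subst povm_on_cong[OF effect_kernel_mat_of_effect])
qed

lemma bdd_above_payoff:
  "bdd_above {payoff dN dS dA dB \<Phi> \<rho> k M D | D. is_povm (dS * dA) k D}"
proof (rule bdd_aboveI, clarify)
  fix D assume D: "is_povm (dS * dA) k D"
  let ?c = "\<lambda>i n s a b n' s' a' b'.
    \<Phi> $$ (n * dS + s, n' * dS + s') * \<rho> $$ (a * dB + b, a' * dB + b')
      * M i $$ (n' * dB + b', n * dB + b)"
  have "payoff dN dS dA dB \<Phi> \<rho> k M D \<le> cmod (\<Sum>i<k.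
     \<Sum>n<dN. \<Sum>s<dS. \<Sum>a<dA. \<Sum>b<dB. \<Sum>n'<dN. \<Sum>s'<dS. \<Sum>a'<dA. \<Sum>b'<dB.
       ?c i n s a b n' s' a' b' * D i $$ (s' * dA + a', s * dA + a))"
    unfolding payoff_def by (rule complex_Re_le_cmod)
  also have "\<dots> \<le> (\<Sum>i<k.
     \<Sum>n<dN. \<Sum>s<dS. \<Sum>a<dA. \<Sum>b<dB. \<Sum>n'<dN. \<Sum>s'<dS. \<Sum>a'<dA. \<Sum>b'<dB.
       cmod (?c i n s a b n' s' a' b'))"
  proof (intro sum_norm_le)
    fix i n s a b n' s' a' b'
    assume "i \<in> {..<k}" "s \<in> {..<dS}" "a \<in> {..<dA}" "s' \<in> {..<dS}" "a' \<in> {..<dA}"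
    then have "cmod (effect_kernel dA (D i) (s, a) (s', a')) \<le> 1"
      using D unfolding is_povm_tensor_iff
      by (intro povm_on_norm_le[where I = "{..<dS} \<times> {..<dA}"]) auto
    then show "cmod (?c i n s a b n' s' a' b' * D i $$ (s' * dA + a', s * dA + a))
        \<le> cmod (?c i n s a b n' s' a' b')"
      unfolding norm_mult[of "?c i n s a b n' s' a' b'"]
      by (intro mult_left_le) (simp_all add: effect_kernel_def tensor_entry_def tensor_index_def)
  qed
  finally show "payoff dN dS dA dB \<Phi> \<rho> k M D \<le> (\<Sum>i<k.
     \<Sum>n<dN. \<Sum>s<dS. \<Sum>a<dA. \<Sum>b<dB. \<Sum>n'<dN. \<Sum>s'<dS. \<Sum>a'<dA. \<Sum>b'<dB.
       cmod (?c i n s a b n' s' a' b'))" .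
qed

lemma payoff_le_opt_payoff:
  assumes "is_povm (dS * dA) k D"
  shows "payoff dN dS dA dB \<Phi> \<rho> k M D \<le> opt_payoff dN dS dA dB \<Phi> \<rho> k M"
  unfolding opt_payoff_def using assms by (intro cSup_upper bdd_above_payoff) blast

lemma opt_payoff_le:
  assumes "k \<ge> 1" and "\<And>D. is_povm (dS * dA) k D \<Longrightarrow> payoff dN dS dA dB \<Phi> \<rho> k M D \<le> c"
  shows "opt_payoff dN dS dA dB \<Phi> \<rho> k M \<le> c"
  unfolding opt_payoff_def
proof (rule cSup_least)
  show "{payoff dN dS dA dB \<Phi> \<rho> k M D | D. is_povm (dS * dA) k D} \<noteq> {}"
    using is_povm_mat_of_effect[OF povm_on_uniform[OF _ \<open>k \<ge> 1\<close>]] by fastforce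
qed (use assms(2) in blast)

lemma povm_with_equal_payoff_exists:
  assumes C: "channel_kernel {..<dS} {..<dT} C"
    and \<Psi>: "\<And>p q. p \<in> {..<dN} \<times> {..<dT} \<Longrightarrow> q \<in> {..<dN} \<times> {..<dT} \<Longrightarrow>
      tensor_entry dT \<Psi> p q = link_product {..<dS} (tensor_entry dS \<Phi>) C p q"
    and D: "is_povm (dT * dA) k D"
  obtains D' where "is_povm (dS * dA) k D'"
    "\<And>dB \<rho> M. payoff dN dT dA dB \<Psi> \<rho> k M D = payoff dN dS dA dB \<Phi> \<rho> k M D'"
proof
  define P where "P i = effect_kernel dA (D i)" for i
  define Q where "Q i = link_product {..<dT} C (P i)" for i
  let ?D' = "\<lambda>i. mat_of_effect dS dA (Q i)"
  have "povm_on ({..<dT} \<times> {..<dA}) k P"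
    using D by (simp add: is_povm_tensor_iff P_def[abs_def])
  then show "is_povm (dS * dA) k ?D'"
    unfolding Q_def by (intro is_povm_mat_of_effect povm_on_link_product C) simp_all
  show "payoff dN dT dA dB \<Psi> \<rho> k M D = payoff dN dS dA dB \<Phi> \<rho> k M ?D'" for dB \<rho> M
  proof (rule payoff_eqI)
    fix i p q assume pq: "p \<in> {..<dN} \<times> {..<dA}" "q \<in> {..<dN} \<times> {..<dA}"
    have "link_product {..<dT} (tensor_entry dT \<Psi>) (P i) p q
        = link_product {..<dT} (link_product {..<dS} (tensor_entry dS \<Phi>) C) (P i) p q"
      by (rule link_product_cong[OF pq \<Psi> refl])
    also have "\<dots> = link_product {..<dS} (tensor_entry dS \<Phi>) (Q i) p q"
      by (simp only: link_product_assoc Q_def)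
    also have "\<dots> = link_product {..<dS} (tensor_entry dS \<Phi>) (effect_kernel dA (?D' i)) p q"
      by (rule link_product_cong[OF pq refl effect_kernel_mat_of_effect[symmetric]])
    finally show "link_product {..<dT} (tensor_entry dT \<Psi>) (effect_kernel dA (D i)) p q
        = link_product {..<dS} (tensor_entry dS \<Phi>) (effect_kernel dA (?D' i)) p q"
      unfolding P_def .
  qed
qed

lemma degrades_to_imp_better:
  assumes "degrades_to {..<dN} {..<dS} {..<dT} (tensor_entry dS \<Phi>) (tensor_entry dT \<Psi>)"
  shows "better dN dS dT \<Phi> \<Psi>"
  unfolding better_def
proof (intro allI impI, elim conjE)
  fix dA dB k :: nat and \<rho> and M :: "nat \<Rightarrow> complex mat"
  assume "k \<ge> 1"
  obtain C where C: "channel_kernel {..<dS} {..<dT} C"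
    and \<Psi>: "\<And>p q. p \<in> {..<dN} \<times> {..<dT} \<Longrightarrow> q \<in> {..<dN} \<times> {..<dT} \<Longrightarrow>
      tensor_entry dT \<Psi> p q = link_product {..<dS} (tensor_entry dS \<Phi>) C p q"
    using assms unfolding degrades_to_def by blast
  show "opt_payoff dN dT dA dB \<Psi> \<rho> k M \<le> opt_payoff dN dS dA dB \<Phi> \<rho> k M"
  proof (rule opt_payoff_le[OF \<open>k \<ge> 1\<close>])
    fix D assume "is_povm (dT * dA) k D"
    then obtain D' where "is_povm (dS * dA) k D'"
      "payoff dN dT dA dB \<Psi> \<rho> k M D = payoff dN dS dA dB \<Phi> \<rho> k M D'"
      using povm_with_equal_payoff_exists[OF C \<Psi>] by metis
    then show "payoff dN dT dA dB \<Psi> \<rho> k M D \<le> opt_payoff dN dS dA dB \<Phi> \<rho> k M"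
      by (simp add: payoff_le_opt_payoff)
  qed
qed

definition correction_game :: "nat \<Rightarrow> nat \<Rightarrow> nat \<Rightarrow> (nat \<times> nat) kernel \<Rightarrow>
    (nat \<Rightarrow> (nat \<times> nat) kernel) \<Rightarrow> nat \<Rightarrow> complex mat" where
  "correction_game dN dB dT G U i =
    tensor_mat dN dB (link_product {..<dT} G (adjoint_kernel (U i)))"

lemma payoff_correction_game:
  "payoff dN dS dA dB \<Phi> \<rho> k (correction_game dN dB dT G U) D
    = Re (kernel_trace ({..<dN} \<times> {..<dT}) G (link_product {..<dS} (tensor_entry dS \<Phi>)
        (measure_and_correct {..<dA} {..<dB} k (\<lambda>i. effect_kernel dA (D i))
          (tensor_entry dB \<rho>) U)))"
proof -
  let ?NB = "{..<dN} \<times> {..<dB}" and ?NT = "{..<dN} \<times> {..<dT}"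
    and ?link = "link_product {..<dS} (tensor_entry dS \<Phi>)"
    and ?prepare = "\<lambda>P. link_product {..<dA} P (tensor_entry dB \<rho>)"
    and ?correct = "\<lambda>i X. link_product {..<dB} X (U i)"
  have "kernel_trace ?NB (tensor_entry dB (correction_game dN dB dT G U i)) (?prepare (?link P))
      = kernel_trace ?NT G (?link (?correct i (?prepare P)))" for i P
  proof -
    have "kernel_trace ?NB (tensor_entry dB (correction_game dN dB dT G U i)) (?prepare (?link P))
        = kernel_trace ?NB (link_product {..<dT} G (adjoint_kernel (U i))) (?prepare (?link P))"
      unfolding correction_game_def by (rule kernel_trace_cong[OF tensor_entry_tensor_mat refl])
    also have "\<dots> = kernel_trace ?NT G (?correct i (?prepare (?link P)))"
      by (rule kernel_trace_link_product[symmetric])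
    also have "\<dots> = kernel_trace ?NT G (?link (?correct i (?prepare P)))"
      by (simp only: link_product_assoc)
    finally show ?thesis .
  qed
  then show ?thesis
    by (simp only: payoff_eq_kernel_trace measure_and_correct_def link_product_sum_right[abs_def]
        kernel_trace_sum_right)
qed

lemma hermitian_op_correction_game:
  assumes G: "hermitian_on ({..<dN} \<times> {..<dT}) G" and U: "channel_kernel {..<dB} {..<dT} (U i)"
  shows "hermitian_op (dN * dB) (correction_game dN dB dT G U i)"
proof -
  have "hermitian_on ({..<dB} \<times> {..<dT}) (U i)"
    using U by (intro psd_on_hermitian_on) (simp_all add: channel_kernel_def)
  then have "hermitian_on ({..<dN} \<times> {..<dB}) (link_product {..<dT} G (adjoint_kernel (U i)))"
    by (intro hermitian_on_link_product G hermitian_on_adjoint_kernel)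
  then show ?thesis
    by (simp add: correction_game_def hermitian_op_tensor_mat)
qed

lemma (in unitary_error_basis) payoff_teleportation:
  "payoff dN d d d \<Psi> (tensor_mat d d entangled_kernel) (d * d)
      (correction_game dN d d G correction_kernel) (\<lambda>i. mat_of_effect d d (bell_kernel i))
    = Re (kernel_trace ({..<dN} \<times> {..<d}) G (tensor_entry d \<Psi>))"
  unfolding payoff_correction_game
proof (intro arg_cong[where f = Re] kernel_trace_cong refl)
  fix p q assume pq: "p \<in> {..<dN} \<times> {..<d}" "q \<in> {..<dN} \<times> {..<d}"
  let ?channel = "measure_and_correct {..<d} {..<d} (d * d)
    (\<lambda>i. effect_kernel d (mat_of_effect d d (bell_kernel i)))
    (tensor_entry d (tensor_mat d d entangled_kernel)) correction_kernel"
  have "?channel p q = identity_kernel p q"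
    if pq: "p \<in> {..<d} \<times> {..<d}" "q \<in> {..<d} \<times> {..<d}" for p q
    unfolding teleportation[OF pq, symmetric]
    by (rule measure_and_correct_cong[OF pq])
      (simp_all add: effect_kernel_mat_of_effect tensor_entry_tensor_mat)
  then have "link_product {..<d} (tensor_entry d \<Psi>) ?channel p q
      = link_product {..<d} (tensor_entry d \<Psi>) identity_kernel p q"
    by (rule link_product_cong[OF pq refl])
  also have "\<dots> = tensor_entry d \<Psi> p q"
    by (rule link_product_identity_right[OF finite_lessThan pq])
  finally show "link_product {..<d} (tensor_entry d \<Psi>) ?channel p q = tensor_entry d \<Psi> p q" .
qed

lemma better_imp_kernel_trace_le:
  assumes better: "better dN dS dT \<Phi> \<Psi>" and "dT > 0"
    and G: "hermitian_on ({..<dN} \<times> {..<dT}) G"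
    and bound: "\<And>C. channel_kernel {..<dS} {..<dT} C \<Longrightarrow>
      Re (kernel_trace ({..<dN} \<times> {..<dT}) G (link_product {..<dS} (tensor_entry dS \<Phi>) C)) \<le> c"
  shows "Re (kernel_trace ({..<dN} \<times> {..<dT}) G (tensor_entry dT \<Psi>)) \<le> c"
proof -
  interpret unitary_error_basis dT "weyl dT"
    using weyl_unitary_error_basis[OF \<open>dT > 0\<close>] .
  let ?k = "dT * dT" and ?\<rho> = "tensor_mat dT dT entangled_kernel"
    and ?M = "correction_game dN dT dT G correction_kernel"
  have "?k \<ge> 1" using \<open>dT > 0\<close> by (simp add: Suc_le_eq)
  have \<rho>: "density_op (dT * dT) ?\<rho>"
    by (simp add: density_op_tensor_mat_iff psd_on_entangled_kernel trace_entangled_kernel)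
  have M: "hermitian_op (dN * dT) (?M i)" if "i < ?k" for i
    using hermitian_op_correction_game[where U = correction_kernel, OF G]
      channel_kernel_correction_kernel[OF that] by blast
  have "Re (kernel_trace ({..<dN} \<times> {..<dT}) G (tensor_entry dT \<Psi>))
      \<le> opt_payoff dN dT dT dT \<Psi> ?\<rho> ?k ?M"
    unfolding payoff_teleportation[symmetric]
    by (intro payoff_le_opt_payoff is_povm_mat_of_effect povm_on_bell_kernel)
  also have "\<dots> \<le> opt_payoff dN dS dT dT \<Phi> ?\<rho> ?k ?M"
    using better \<rho> \<open>?k \<ge> 1\<close> M unfolding better_def by blast
  also have "\<dots> \<le> c"
  proof (rule opt_payoff_le[OF \<open>?k \<ge> 1\<close>])
    fix D assume "is_povm (dS * dT) ?k D"
    then have "povm_on ({..<dS} \<times> {..<dT}) ?k (\<lambda>i. effect_kernel dT (D i))"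
      by (simp add: is_povm_tensor_iff)
    then show "payoff dN dS dT dT \<Phi> ?\<rho> ?k ?M D \<le> c"
      using \<rho> channel_kernel_correction_kernel
      unfolding payoff_correction_game density_op_tensor_iff
      by (intro bound channel_kernel_measure_and_correct) auto
  qed
  finally show ?thesis .
qed

lemma better_imp_degrades_to:
  assumes "psd_op (dN * dS) \<Phi>" "psd_op (dN * dT) \<Psi>" "dT > 0" "better dN dS dT \<Phi> \<Psi>"
  shows "degrades_to {..<dN} {..<dS} {..<dT} (tensor_entry dS \<Phi>) (tensor_entry dT \<Psi>)"
proof (rule ccontr)
  assume "\<not> ?thesis"
  then obtain G c where "hermitian_on ({..<dN} \<times> {..<dT}) G"
    and "\<And>C. channel_kernel {..<dS} {..<dT} C \<Longrightarrow>
      Re (kernel_trace ({..<dN} \<times> {..<dT}) G (link_product {..<dS} (tensor_entry dS \<Phi>) C)) \<le> c"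
    and "c < Re (kernel_trace ({..<dN} \<times> {..<dT}) G (tensor_entry dT \<Psi>))"
    using separating_hermitian_kernel_exists[of "{..<dN}" "{..<dS}" "{..<dT}" "tensor_entry dS \<Phi>"
        "tensor_entry dT \<Psi>"] assms(1-3) by (auto simp: psd_op_tensor_iff)
  with better_imp_kernel_trace_le[OF assms(4,3)] show False by fastforce
qed

theorem theorem2:
  fixes dN dS dT :: nat and \<Phi> \<Psi> :: "complex mat"
  assumes "density_op (dN * dS) \<Phi>"
    and "density_op (dN * dT) \<Psi>"
  shows "better dN dS dT \<Phi> \<Psi> \<longleftrightarrow>
    (\<exists>E. cptp dS dT E \<and> \<Psi> = id_tensor dN dS dT E \<Phi>)"
proof -
  have psd: "psd_op (dN * dS) \<Phi>" "psd_op (dN * dT) \<Psi>" and "mtrace \<Psi> = 1"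
    using assms by (simp_all add: density_op_def)
  then have carrier: "\<Psi> \<in> carrier_mat (dN * dT) (dN * dT)"
    by (simp add: psd_op_def)
  with \<open>mtrace \<Psi> = 1\<close> have "dT > 0"
    by (intro gr0I) (simp add: mtrace_def)
  show ?thesis
    unfolding ex_cptp_iff_degrades_to[OF carrier]
    using degrades_to_imp_better better_imp_degrades_to[OF psd \<open>dT > 0\<close>] by blast
qed

end
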